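(* Let $X$ be a finite skew brace of nilpotent type, $G=(X,+)$, $L=L_\infty(X)$, $Q=G/L$, and let $\Delta\leq\operatorname{Aut}(Q)$ be the group induced by $\lambda(X,\cdot)$ on $Q$. For every prime $p$ let $G_p$ be the Sylow $p$-subgroup of $G$, $L_p=L\cap G_p$, $Q_p=G_p/L_p$, and $\Delta_p=\Delta/C_\Delta(Q_p)$, the group induced by $\Delta$ on $Q_p$; identify $Q$ with $\prod_pQ_p$. Then $$\Delta\cong\prod_p\Delta_p\qquad\text{and}\qquad Q\rtimes\Delta\cong\prod_p(Q_p\rtimes\Delta_p).$$ Under these identifications, the Sylow $q$-subgroup of $\Delta$ centralizes $Q_p$ whenever $q\neq p$.
   Context: A skew (left) brace is a triple $X=(X,+,\cdot)$ such that $(X,+)$ and $(X,\cdot)$ are groups on the same set and $a\cdot(b+c)=a\cdot b-a+a\cdot c$ for all $a,b,c\in X$. $X$ is of nilpotent type if $(X,+)$ is nilpotent. Put $\lambda_a(b)=-a+a\cdot b$; then $\lambda:(X,\cdot)\to\operatorname{Aut}(X,+)$ is a group homomorphism. Put $a*b=\lambda_a(b)-b$; for subsets $S,T$, $S*T$ is the subgroup of $(X,+)$ generated by all $s*t$, $s\in S$, $t\in T$. The left series is $X^1=X$, $X^{n+1}=X*X^n$, and $L_\infty(X)=\bigcap_{n\ge1}X^n$. For $X$ of nilpotent type, $L=L_\infty(X)$ is normal in $(X,+)$ and invariant under all $\lambda_a$, so each $\lambda_a$ induces an automorphism of $Q=G/L$; $\Delta$ is the group of these induced automorphisms. Since $G$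 is nilpotent, $G=\prod_pG_p$ and $L=\prod_pL_p$, giving the natural isomorphism $Q\cong\prod_pQ_p$ used for the identification; each $Q_p$ is $\Delta$-invariant. The identification $\Delta\cong\prod_p\Delta_p$ is via the natural map induced by $\Delta\to\Delta_p$ for each $p$. *)

theory Defs
  imports
    "HOL-Algebra.Ring"
    "HOL-Algebra.Bij"
    "HOL-Algebra.Product_Groups"
    "HOL-Computational_Algebra.Primes"
begin

section \<open>Groups\<close>

primrec lower_central_series :: "('a, 'b) monoid_scheme \<Rightarrow> nat \<Rightarrow> 'a set" where
  "lower_central_series G 0 = carrier G"
| "lower_central_series G (Suc n) =
     generate G {x \<otimes>\<^bsub>G\<^esub> y \<otimes>\<^bsub>G\<^esub> inv\<^bsub>G\<^esub> x \<otimes>\<^bsub>G\<^esub> inv\<^bsub>G\<^esub> y | x y.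
       x \<in> lower_central_series G n \<and> y \<in> carrier G}"

definition nilpotent_group :: "('a, 'b) monoid_scheme \<Rightarrow> bool" where
  "nilpotent_group G \<longleftrightarrow> group G \<and> (\<exists>n. lower_central_series G n = {\<one>\<^bsub>G\<^esub>})"

definition sylow_subgroup :: "nat \<Rightarrow> ('a, 'b) monoid_scheme \<Rightarrow> 'a set \<Rightarrow> bool" where
  "sylow_subgroup p G P \<longleftrightarrow> subgroup P G \<and> card P = p ^ multiplicity p (order G)"

text \<open>Only used for finite nilpotent groups, where there is exactly one Sylow \<open>p\<close>-subgroup.\<close>

definition the_sylow :: "('a, 'b) monoid_scheme \<Rightarrow> nat \<Rightarrow> 'a set" where
  "the_sylow G p = (THE P. sylow_subgroup p G P)"

definition semidirect_product ::
  "('a, 'b) monoid_scheme \<Rightarrow> ('c, 'd) monoid_scheme \<Rightarrow> ('c \<Rightarrow> 'a \<Rightarrow> 'a) \<Rightarrow> ('a \<times> 'c) monoid" where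
  "semidirect_product N H \<phi> =
     \<lparr>carrier = carrier N \<times> carrier H,
      monoid.mult = (\<lambda>(n, h) (n', h'). (n \<otimes>\<^bsub>N\<^esub> \<phi> h n', h \<otimes>\<^bsub>H\<^esub> h')),
      one = (\<one>\<^bsub>N\<^esub>, \<one>\<^bsub>H\<^esub>)\<rparr>"

section \<open>Skew braces\<close>

text \<open>
  The record type of rings serves as the type of triples $(X,+,\cdot)$; none of the ring
  axioms are assumed. The group $(X,+)$ is \<open>add_monoid X\<close>, not necessarily abelian,
  and $(X,\cdot)$ is \<open>X\<close> itself, read as a monoid.
\<close>

locale skew_brace =
  fixes X :: "('a, 'm) ring_scheme" (structure)
  assumes add_group: "group (add_monoid X)"
    and mult_group: "group X"
    and brace_distrib: "\<lbrakk>a \<in> carrier X; b \<in> carrier X; c \<in> carrier X\<rbrakk>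
      \<Longrightarrow> a \<otimes> (b \<oplus> c) = ((a \<otimes> b) \<ominus> a) \<oplus> (a \<otimes> c)"

definition nilpotent_type :: "('a, 'm) ring_scheme \<Rightarrow> bool" where
  "nilpotent_type X \<longleftrightarrow> nilpotent_group (add_monoid X)"

definition brace_lambda :: "('a, 'm) ring_scheme \<Rightarrow> 'a \<Rightarrow> 'a \<Rightarrow> 'a" where
  "brace_lambda X a b = (\<ominus>\<^bsub>X\<^esub> a) \<oplus>\<^bsub>X\<^esub> (a \<otimes>\<^bsub>X\<^esub> b)"

definition brace_star :: "('a, 'm) ring_scheme \<Rightarrow> 'a \<Rightarrow> 'a \<Rightarrow> 'a" where
  "brace_star X a b = brace_lambda X a b \<ominus>\<^bsub>X\<^esub> b"

definition brace_star_set :: "('a, 'm) ring_scheme \<Rightarrow> 'a set \<Rightarrow> 'a set \<Rightarrow> 'a set" where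
  "brace_star_set X S T = generate (add_monoid X) {brace_star X s t | s t. s \<in> S \<and> t \<in> T}"

text \<open>The numbering starts at 0: \<open>left_series X n\<close> is $X^{n+1}$.\<close>

primrec left_series :: "('a, 'm) ring_scheme \<Rightarrow> nat \<Rightarrow> 'a set" where
  "left_series X 0 = carrier X"
| "left_series X (Suc n) = brace_star_set X (carrier X) (left_series X n)"

definition L_inf :: "('a, 'm) ring_scheme \<Rightarrow> 'a set" where
  "L_inf X = (\<Inter>n. left_series X n)"

section \<open>The quotient \<open>Q\<close> and the group \<open>\<Delta>\<close>\<close>

definition Q_quot :: "('a, 'm) ring_scheme \<Rightarrow> 'a set monoid" where
  "Q_quot X = add_monoid X Mod L_inf X"

definition induced_aut :: "('a, 'm) ring_scheme \<Rightarrow> 'a \<Rightarrow> 'a set \<Rightarrow> 'a set" where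
  "induced_aut X a = (\<lambda>C \<in> carrier (Q_quot X). brace_lambda X a ` C)"

definition Delta :: "('a, 'm) ring_scheme \<Rightarrow> ('a set \<Rightarrow> 'a set) monoid" where
  "Delta X = AutoGroup (Q_quot X) \<lparr>carrier := induced_aut X ` carrier X\<rparr>"

section \<open>Primary components\<close>

definition G_p :: "('a, 'm) ring_scheme \<Rightarrow> nat \<Rightarrow> 'a set" where
  "G_p X p = the_sylow (add_monoid X) p"

definition L_p :: "('a, 'm) ring_scheme \<Rightarrow> nat \<Rightarrow> 'a set" where
  "L_p X p = L_inf X \<inter> G_p X p"

definition Q_p :: "('a, 'm) ring_scheme \<Rightarrow> nat \<Rightarrow> 'a set monoid" where
  "Q_p X p = (add_monoid X \<lparr>carrier := G_p X p\<rparr>) Mod L_p X p"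

definition G_p_compl :: "('a, 'm) ring_scheme \<Rightarrow> nat \<Rightarrow> 'a set" where
  "G_p_compl X p = generate (add_monoid X) (\<Union>q \<in> {q. prime q \<and> q \<noteq> p}. G_p X q)"

text \<open>
  The identification of $Q$ with $\prod_p Q_p$. In one direction it consists of the embeddings
  $Q_p \to Q$, $L_p + x \mapsto L + x$; the image is written as the set sum of \<open>L\<close>
  and the coset. In the other direction it consists of the projections $Q \to Q_p$, induced by the
  projection of $G$ onto the direct factor $G_p$ along the product of the other Sylow
  subgroups: a coset $C$ of $L = \prod_q L_q$ is sent to the set of the $G_p$-components of its
  elements, which is a coset of $L_p$.
\<close>

definition Q_embed :: "('a, 'm) ring_scheme \<Rightarrow> 'a set \<Rightarrow> 'a set" where
  "Q_embed X D = L_inf X <#>\<^bsub>add_monoid X\<^esub> D"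

definition Q_proj :: "('a, 'm) ring_scheme \<Rightarrow> nat \<Rightarrow> 'a set \<Rightarrow> 'a set" where
  "Q_proj X p C = {g \<in> G_p X p. \<exists>h \<in> G_p_compl X p. g \<oplus>\<^bsub>X\<^esub> h \<in> C}"

definition Delta_centralizer :: "('a, 'm) ring_scheme \<Rightarrow> nat \<Rightarrow> ('a set \<Rightarrow> 'a set) set" where
  "Delta_centralizer X p =
     {\<delta> \<in> carrier (Delta X). \<forall>D \<in> carrier (Q_p X p). \<delta> (Q_embed X D) = Q_embed X D}"

definition Delta_p :: "('a, 'm) ring_scheme \<Rightarrow> nat \<Rightarrow> ('a set \<Rightarrow> 'a set) set monoid" where
  "Delta_p X p = Delta X Mod Delta_centralizer X p"

definition Delta_restr ::
  "('a, 'm) ring_scheme \<Rightarrow> nat \<Rightarrow> ('a set \<Rightarrow> 'a set) \<Rightarrow> 'a set \<Rightarrow> 'a set" where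
  "Delta_restr X p \<delta> = (\<lambda>D \<in> carrier (Q_p X p). Q_proj X p (\<delta> (Q_embed X D)))"

text \<open>
  All elements of a coset \<open>K\<close> of the centralizer of $Q_p$ restrict to the same automorphism
  of $Q_p$, which is how \<open>K\<close> acts.
\<close>

definition Delta_p_action ::
  "('a, 'm) ring_scheme \<Rightarrow> nat \<Rightarrow> ('a set \<Rightarrow> 'a set) set \<Rightarrow> 'a set \<Rightarrow> 'a set" where
  "Delta_p_action X p K = the_elem (Delta_restr X p ` K)"

section \<open>The natural maps\<close>

definition Delta_to_prod ::
  "('a, 'm) ring_scheme \<Rightarrow> ('a set \<Rightarrow> 'a set) \<Rightarrow> nat \<Rightarrow> ('a set \<Rightarrow> 'a set) set" where
  "Delta_to_prod X \<delta> = (\<lambda>p \<in> {p. prime p}. Delta_centralizer X p #>\<^bsub>Delta X\<^esub> \<delta>)"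

definition semidirect_to_prod ::
  "('a, 'm) ring_scheme \<Rightarrow> 'a set \<times> ('a set \<Rightarrow> 'a set)
     \<Rightarrow> nat \<Rightarrow> 'a set \<times> ('a set \<Rightarrow> 'a set) set" where
  "semidirect_to_prod X = (\<lambda>(C, \<delta>). \<lambda>p \<in> {p. prime p}. (Q_proj X p C, Delta_to_prod X \<delta> p))"

end

theory Submission
  imports Defs "HOL-Number_Theory.Cong" "HOL-Algebra.Multiplicative_Group" "HOL-Algebra.Sylow"
    "HOL-Algebra.SndIsomorphismGrp" "HOL-Algebra.Group_Action"
begin

text \<open>
  Of the skew brace only the action of its multiplicative group by the automorphisms
  $\lambda_a$ of the nilpotent additive group matters. So let a finite group $A$ act on a finite
  nilpotent group $G$, let $V_0 = G$, let $V_{n+1}$ be generated by all $a(x) x^{-1}$ with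
  $x \in V_n$, and let $L$ be the intersection of the $V_n$.

  The group $A$ acts trivially along the chain of the $V_n$, from which it follows that a
  $q$-subgroup $S$ of $A$ acts trivially on $G_p$ modulo $L$ for $q \neq p$: it permutes the
  elements of the coset $(V_{n+1} \cap G_p) l$ for every $l \in V_n \cap G_p$, and as $q$ does not
  divide the size of the coset, it fixes one of them
  (\<open>fixed_point_decomposition\<close>, \<open>sylow_in_residual_kernel\<close>). Hence the group $\Delta_p$ induced
  on $Q_p$ is a $p$-group. Since the $Q_p$ generate $Q$, an element of $\Delta$ that is trivial in
  every $\Delta_p$ is trivial. A finite group with one quotient of $p$-power order for each prime
  $p$, whose kernels intersect trivially, is the product of these quotients by the argument of
  the Chinese remainder theorem; its Sylow $q$-subgroup is unique and lies in the kernel for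
  each $p \neq q$ (locale \<open>prime_power_quotients\<close>). This applies to $\Delta$ with the quotients
  $\Delta_p$ and to $Q$ with the quotients $Q_p$, and the two isomorphisms respect the actions,
  which gives the decomposition of the semidirect product.

  That $L$ is normal in $G$, so that $Q$ is a group at all, needs a proof
  (\<open>residual_normal\<close>). Let $B$ be the kernel of the action on $G_p$ modulo $L$. The
  subgroup $K$ generated by all $a(g) g^{-1}$ with $a \in B$ and $g \in G_p$ is contained in
  $L_p = L \cap G_p$ and normal in $G_p$ by a commutator identity, and $A$ acts on the cosets of
  $K$ in $L_p$ like a $p$-group, because $B$ contains all Sylow subgroups of $A$ for other
  primes. A $p$-group acts nilpotently on a $p$-group, but $L$ is generated by its commutators
  with $A$; therefore $K = L_p$.

  Passing between $G$ and the $G_p$ is done by taking $p$-parts. This is the projection of $G$ onto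
  its direct factor $G_p$, and at the same time the power map for a fixed exponent, so it
  commutes with all automorphisms and maps every subgroup into itself.
\<close>

section \<open>Primary parts of elements of finite groups\<close>

text \<open>An exponent that is idempotent modulo \<open>n\<close>: raising an element \<open>x\<close> with \<open>x\<^sup>n = 1\<close> to this power
  extracts its \<open>p\<close>-part. If \<open>p\<close> does not divide \<open>n\<close>, it is a multiple of \<open>n\<close>.\<close>

definition primary_exponent :: "nat \<Rightarrow> nat \<Rightarrow> nat" where
  "primary_exponent n p =
     (SOME e. [e = 1] (mod p ^ multiplicity p n) \<and> n div p ^ multiplicity p n dvd e)"

lemma primary_exponent:
  assumes "0 < n" "prime p"
  shows "[primary_exponent n p = 1] (mod p ^ multiplicity p n)"
    and "n div p ^ multiplicity p n dvd primary_exponent n p"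
proof -
  let ?k = "p ^ multiplicity p n" and ?m = "n div p ^ multiplicity p n"
  have "coprime ?m ?k"
    using assms multiplicity_decompose[of n p]
    by (metis bot_nat_0.not_eq_extremum coprime_commute coprime_power_right_iff not_prime_unit prime_imp_coprime)
  then obtain x where "[?m * x = 1] (mod ?k)"
    using cong_solve_coprime_nat[of ?m ?k] unfolding One_nat_def by blast
  then have "\<exists>e. [e = 1] (mod ?k) \<and> ?m dvd e"
    by (intro exI[of _ "?m * x"]) auto
  then have *: "[primary_exponent n p = 1] (mod ?k) \<and> ?m dvd primary_exponent n p"
    unfolding primary_exponent_def by (rule someI_ex)
  from * show "[primary_exponent n p = 1] (mod ?k)" "?m dvd primary_exponent n p"
    by auto
qed

lemma dvd_prime_part:
  fixes d n p :: nat
  assumes "0 < n" "prime p" "d dvd p ^ a" "d dvd n"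
  shows "d dvd p ^ multiplicity p n"
proof -
  obtain b where "d = p ^ b"
    using assms divides_primepow_nat by blast
  then show ?thesis
    using assms by (metis le_imp_power_dvd multiplicity_geI bot_nat_0.not_eq_extremum not_prime_unit)
qed

lemma dvd_prime_complement:
  fixes d n p :: nat
  assumes "0 < n" "prime p" "coprime d p" "d dvd n"
  shows "d dvd n div p ^ multiplicity p n"
proof -
  have "n = p ^ multiplicity p n * (n div p ^ multiplicity p n)"
    by (simp add: multiplicity_dvd)
  then show ?thesis
    using assms by (metis coprime_dvd_mult_right_iff coprime_power_right_iff)
qed

context group
begin

lemma pow_coprime_imp_one:
  assumes "x \<in> carrier G" "x [^] (m::nat) = \<one>" "x [^] (n::nat) = \<one>" "coprime m n"
  shows "x = \<one>"
proof -
  have "ord x dvd m" "ord x dvd n"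
    using assms pow_eq_id by auto
  then have "ord x = 1"
    using assms(4) by (metis coprime_common_divisor_nat nat_dvd_1_iff_1)
  then show ?thesis
    using assms ord_eq_1 by auto
qed

text \<open>Here \<open>n\<close> is any exponent of \<open>x\<close>, so that the lemmas apply to the homomorphic images of
  elements of a group of order \<open>n\<close>.\<close>

lemma primary_exponent_fixes:
  assumes "x \<in> carrier G" "0 < n" "prime p" "x [^] n = \<one>" "x [^] (p ^ a) = \<one>"
  shows "x [^] primary_exponent n p = x"
proof -
  let ?e = "primary_exponent n p"
  have "ord x dvd p ^ multiplicity p n"
    using assms dvd_prime_part pow_eq_id by blast
  then have "[?e = 1] (mod ord x)"
    using primary_exponent(1)[of n p] assms cong_dvd_modulus_nat by blast
  then have "x [^] ?e = x [^] (1::nat)"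
    using assms(1) by (metis int_pow_eq int_pow_int cong_int_iff cong_iff_dvd_diff cong_sym)
  then show ?thesis using assms(1) by simp
qed

lemma primary_exponent_kills:
  assumes "x \<in> carrier G" "0 < n" "prime p" "x [^] n = \<one>" "x [^] (m::nat) = \<one>" "coprime m p"
  shows "x [^] primary_exponent n p = \<one>"
proof -
  have "ord x dvd m" "ord x dvd n"
    using assms pow_eq_id by auto
  then have "coprime (ord x) p"
    using assms(6) by (metis coprime_divisors dvd_refl)
  then have "ord x dvd n div p ^ multiplicity p n"
    using \<open>ord x dvd n\<close> assms dvd_prime_complement by blast
  then show ?thesis
    using primary_exponent(2)[of n p] assms pow_eq_id dvd_trans by blast
qed

lemma primary_exponent_prime_power:
  assumes "x \<in> carrier G" "0 < n" "prime p" "x [^] n = \<one>"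
  shows "(x [^] primary_exponent n p) [^] (p ^ multiplicity p n) = \<one>"
proof -
  let ?e = "primary_exponent n p" and ?k = "p ^ multiplicity p n"
  have "n = (n div ?k) * ?k"
    by (simp add: multiplicity_dvd)
  then have "n dvd ?e * ?k"
    using primary_exponent(2)[of n p] assms by (metis dvd_refl mult_dvd_mono)
  then show ?thesis
    using assms by (simp add: nat_pow_pow) (meson dvd_trans pow_eq_id)
qed

lemma subgroup_pow_closed:
  assumes "subgroup H G" "x \<in> H"
  shows "x [^] (n::nat) \<in> H"
  using assms by (induction n) (auto simp: subgroup.one_closed subgroup.m_closed)

text \<open>The least positive exponent whose power lies in \<open>H\<close> divides all exponents with
  that property, so it divides the order of the group and all exponents of primary parts,
  which have no common prime factor.\<close>

lemma mem_subgroup_if_primary_parts: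
  assumes fin: "finite (carrier G)" and H: "subgroup H G" and x: "x \<in> carrier G"
    and parts: "\<And>p. prime p \<Longrightarrow> x [^] primary_exponent (order G) p \<in> H"
  shows "x \<in> H"
proof -
  have n: "0 < order G"
    using fin order_gt_0_iff_finite by blast
  have one: "x [^] order G \<in> H"
    using x H by (simp add: pow_order_eq_1 subgroup.one_closed)
  define d where "d = (LEAST k::nat. 0 < k \<and> x [^] k \<in> H)"
  have d: "0 < d \<and> x [^] d \<in> H"
    unfolding d_def by (rule LeastI[of _ "order G"]) (use n one in simp)
  have dvd: "d dvd k" if "x [^] k \<in> H" for k :: nat
  proof (rule ccontr)
    assume "\<not> d dvd k"
    then have r: "0 < k mod d" "k mod d < d" using d by (auto simp: dvd_eq_mod_eq_0)
    have "x [^] k = (x [^] d) [^] (k div d) \<otimes> x [^] (k mod d)"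
      using x by (simp add: nat_pow_pow nat_pow_mult)
    then have "x [^] (k mod d) = inv ((x [^] d) [^] (k div d)) \<otimes> x [^] k"
      using x by (simp add: inv_solve_left m_assoc)
    moreover have "(x [^] d) [^] (k div d) \<in> H"
      using d H subgroup_pow_closed by blast
    ultimately have "x [^] (k mod d) \<in> H"
      using H that by (simp add: subgroup.m_closed subgroup.m_inv_closed)
    then show False
      using r Least_le[of "\<lambda>k. 0 < k \<and> x [^] k \<in> H" "k mod d"] unfolding d_def[symmetric] by auto
  qed
  have "d = 1"
  proof (rule ccontr)
    assume "d \<noteq> 1"
    then obtain r where r: "prime r" "r dvd d" by (metis prime_factor_nat)
    have "r dvd order G" "r dvd primary_exponent (order G) r"
      using r one parts dvd dvd_trans by blast+
    moreover have "r dvd r ^ multiplicity r (order G)"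
      using \<open>r dvd order G\<close> n r(1) by (simp add: prime_multiplicity_gt_zero_iff dvd_power)
    then have "[primary_exponent (order G) r = 1] (mod r)"
      using primary_exponent(1)[of "order G" r] n r cong_dvd_modulus_nat by blast
    ultimately show False
      using r(1) by (metis cong_dvd_iff not_prime_unit)
  qed
  then show ?thesis using d x by simp
qed

lemma sylow_subgroup_pow:
  assumes "sylow_subgroup p G P" "x \<in> P"
  shows "x [^] (p ^ multiplicity p (order G)) = \<one>"
proof -
  have P: "subgroup P G" using assms by (simp add: sylow_subgroup_def)
  show ?thesis
    using group.pow_order_eq_1[OF subgroup_imp_group[OF P], of x] assms
    by (simp add: order_def sylow_subgroup_def nat_pow_consistent[symmetric])
qed

lemma sylow_subgroup_exists:
  assumes "finite (carrier G)" "prime p"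
  obtains S where "sylow_subgroup p G S"
proof -
  obtain m where "order G = p ^ multiplicity p (order G) * m"
    using multiplicity_dvd by blast
  then show ?thesis
    using sylow_thm[OF assms(2) is_group _ assms(1)] that unfolding sylow_subgroup_def by blast
qed

end

section \<open>Groups with enough quotients of prime power order\<close>

locale prime_power_quotients =
  D: group D for D (structure) +
  fixes H :: "nat \<Rightarrow> ('h, 'k) monoid_scheme" and f :: "nat \<Rightarrow> 'a \<Rightarrow> 'h"
  assumes fin: "finite (carrier D)"
    and H_group: "prime p \<Longrightarrow> group (H p)"
    and f_hom: "prime p \<Longrightarrow> f p \<in> hom D (H p)"
    and f_surj: "prime p \<Longrightarrow> f p ` carrier D = carrier (H p)"
    and H_order: "prime p \<Longrightarrow> \<exists>a. order (H p) = p ^ a"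
    and faithful: "\<lbrakk>x \<in> carrier D; \<And>p. prime p \<Longrightarrow> f p x = \<one>\<^bsub>H p\<^esub>\<rbrakk> \<Longrightarrow> x = \<one>"
begin

lemma f_group_hom: "prime p \<Longrightarrow> group_hom D (H p) (f p)"
  by (simp add: group_hom_def group_hom_axioms_def H_group f_hom)

lemma f_pow: "\<lbrakk>prime p; x \<in> carrier D\<rbrakk> \<Longrightarrow> f p (x [^] (n::nat)) = f p x [^]\<^bsub>H p\<^esub> n"
  by (simp add: f_group_hom group_hom.hom_nat_pow)

lemma f_closed: "\<lbrakk>prime p; x \<in> carrier D\<rbrakk> \<Longrightarrow> f p x \<in> carrier (H p)"
  using f_surj by blast

lemma image_order:
  assumes "prime p" "x \<in> carrier D"
  obtains a where "f p x [^]\<^bsub>H p\<^esub> (p ^ a) = \<one>\<^bsub>H p\<^esub>"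
  using assms H_order[of p] by (metis H_group f_closed group.pow_order_eq_1)

lemma image_pow_order:
  assumes "prime p" "x \<in> carrier D"
  shows "f p x [^]\<^bsub>H p\<^esub> order D = \<one>\<^bsub>H p\<^esub>"
  using assms by (metis D.pow_order_eq_1 f_group_hom f_pow group_hom.hom_one)

lemma order_pos: "0 < order D"
  using fin D.order_gt_0_iff_finite by blast

text \<open>A preimage can be made trivial in all other factors without changing it in the \<open>q\<close>-th one, by
  passing to its \<open>q\<close>-part. Products of such preimages realize every family of values.\<close>

lemma preimage_of_factor:
  assumes q: "prime q" and x: "x \<in> carrier D"
  defines "y \<equiv> x [^] primary_exponent (order D) q"
  shows "f q y = f q x" and "\<lbrakk>prime p; p \<noteq> q\<rbrakk> \<Longrightarrow> f p y = \<one>\<^bsub>H p\<^esub>"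
proof -
  obtain a where a: "f q x [^]\<^bsub>H q\<^esub> (q ^ a) = \<one>\<^bsub>H q\<^esub>"
    using image_order q x by blast
  then show "f q y = f q x"
    using group.primary_exponent_fixes[OF H_group[OF q] f_closed[OF q x] order_pos q
        image_pow_order[OF q x] a] q x
    by (simp add: y_def f_pow)
  show "f p y = \<one>\<^bsub>H p\<^esub>" if p: "prime p" "p \<noteq> q" for p
  proof -
    obtain b where "f p x [^]\<^bsub>H p\<^esub> (p ^ b) = \<one>\<^bsub>H p\<^esub>"
      using image_order p x by blast
    moreover have "coprime (p ^ b) q"
      using p q by (simp add: primes_coprime)
    ultimately show ?thesis
      using group.primary_exponent_kills[OF H_group[OF p(1)] f_closed[OF p(1) x] order_pos q
          image_pow_order[OF p(1) x]] p q x
      by (simp add: y_def f_pow)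
  qed
qed

lemma factor_trivial:
  assumes "prime p" "\<not> p dvd order D" "x \<in> carrier D"
  shows "f p x = \<one>\<^bsub>H p\<^esub>"
proof -
  obtain a where a: "f p x [^]\<^bsub>H p\<^esub> (p ^ a) = \<one>\<^bsub>H p\<^esub>"
    using image_order assms by blast
  have "coprime (order D) (p ^ a)"
    using assms by (metis coprime_commute coprime_power_right_iff prime_imp_coprime)
  then show ?thesis
    using group.pow_coprime_imp_one[OF H_group f_closed image_pow_order a] assms by blast
qed

lemma simultaneous_preimage:
  assumes h: "\<And>p. prime p \<Longrightarrow> h p \<in> carrier (H p)"
  shows "\<exists>x \<in> carrier D. \<forall>p. prime p \<longrightarrow> f p x = h p"
proof -
  have claim: "\<exists>x \<in> carrier D. \<forall>p. prime p \<longrightarrow> f p x = (if p \<in> F then h p else \<one>\<^bsub>H p\<^esub>)"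
    if "finite F" "\<forall>p \<in> F. prime p" for F
    using that
  proof (induction F rule: finite_induct)
    case empty
    then show ?case
      by (intro bexI[of _ \<one>]) (auto simp: f_group_hom group_hom.hom_one)
  next
    case (insert q F)
    then obtain x where x: "x \<in> carrier D"
      "\<forall>p. prime p \<longrightarrow> f p x = (if p \<in> F then h p else \<one>\<^bsub>H p\<^esub>)" by auto
    have q: "prime q" using insert by simp
    then obtain z where z: "z \<in> carrier D" "f q z = h q"
      using f_surj[of q] h[of q] by (metis imageE)
    define y where "y = z [^] primary_exponent (order D) q"
    have y: "y \<in> carrier D" using z by (simp add: y_def)
    have "f p (x \<otimes> y) = (if p \<in> insert q F then h p else \<one>\<^bsub>H p\<^esub>)" if p: "prime p" for p
    proof -
      interpret Hp: group "H p" using p by (rule H_group)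
      interpret Hq: group "H q" using q by (rule H_group)
      have *: "f p (x \<otimes> y) = f p x \<otimes>\<^bsub>H p\<^esub> f p y"
        using x y p f_hom[of p] by (simp add: hom_mult)
      have "f p y = (if p = q then h q else \<one>\<^bsub>H p\<^esub>)"
        using preimage_of_factor[OF q z(1)] z(2) p by (auto simp: y_def)
      then show ?thesis
        using * x p insert(2) h[OF p] by (cases "p = q") auto
    qed
    then show ?case using x y by (intro bexI[of _ "x \<otimes> y"]) auto
  qed
  \<comment> \<open>Only finitely many factors are nontrivial, so a finite product of preimages suffices.\<close>
  define F where "F = prime_factors (order D)"
  obtain x where x: "x \<in> carrier D" "\<forall>p. prime p \<longrightarrow> f p x = (if p \<in> F then h p else \<one>\<^bsub>H p\<^esub>)"
    using claim[of F] by (auto simp: F_def)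
  have "f p x = h p" if p: "prime p" for p
  proof (cases "p \<in> F")
    case True
    then show ?thesis using x p by auto
  next
    case False
    then have "\<not> p dvd order D"
      using p order_pos by (auto simp: F_def prime_factors_dvd)
    then have "carrier (H p) = {\<one>\<^bsub>H p\<^esub>}"
      using factor_trivial[OF p] unfolding f_surj[OF p, symmetric] by (auto intro!: image_eqI[of _ _ \<one>])
    then show ?thesis
      using h[OF p] x False p by auto
  qed
  then show ?thesis using x by blast
qed

theorem iso_product_of_quotients:
  "(\<lambda>x. \<lambda>p \<in> {p. prime p}. f p x) \<in> iso D (product_group {p. prime p} H)"
proof -
  let ?F = "\<lambda>x. \<lambda>p \<in> {p. prime p}. f p x"
  have hom: "?F \<in> hom D (product_group {p. prime p} H)"
    by (rule homI) (auto simp: f_closed hom_mult[OF f_hom] intro!: restrict_ext)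
  have grp: "group (product_group {p. prime p} H)"
    by (rule product_group) (simp add: H_group)
  have "inj_on ?F (carrier D)"
    unfolding inj_on_one_iff'[OF hom D.is_group grp]
  proof (intro allI impI)
    fix x assume x: "x \<in> carrier D" "?F x = \<one>\<^bsub>product_group {p. prime p} H\<^esub>"
    then have "f p x = \<one>\<^bsub>H p\<^esub>" if "prime p" for p
      using that by (metis mem_Collect_eq one_product_group restrict_apply')
    then show "x = \<one>" using faithful x by blast
  qed
  moreover have "?F ` carrier D = carrier (product_group {p. prime p} H)"
  proof
    show "?F ` carrier D \<subseteq> carrier (product_group {p. prime p} H)"
      using hom by (rule hom_carrier)
    show "carrier (product_group {p. prime p} H) \<subseteq> ?F ` carrier D"
    proof
      fix h assume h: "h \<in> carrier (product_group {p. prime p} H)"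
      then obtain x where "x \<in> carrier D" "\<forall>p. prime p \<longrightarrow> f p x = h p"
        using simultaneous_preimage[of h] by (auto simp: PiE_iff)
      moreover from this have "h = ?F x"
        using h by (intro ext) (auto simp: PiE_iff extensional_def)
      ultimately show "h \<in> ?F ` carrier D" by blast
    qed
  qed
  ultimately show ?thesis
    using hom by (simp add: iso_def bij_betw_def)
qed

lemma prime_power_element_in_kernel:
  assumes "prime p" "prime q" "p \<noteq> q" "x \<in> carrier D" "x [^] (q ^ k) = \<one>"
  shows "f p x = \<one>\<^bsub>H p\<^esub>"
proof -
  obtain a where a: "f p x [^]\<^bsub>H p\<^esub> (p ^ a) = \<one>\<^bsub>H p\<^esub>"
    using image_order assms by blast
  have "f p x [^]\<^bsub>H p\<^esub> (q ^ k) = \<one>\<^bsub>H p\<^esub>"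
    using assms by (metis f_group_hom f_pow group_hom.hom_one)
  moreover have "coprime (q ^ k) (p ^ a)"
    using assms by (simp add: primes_coprime)
  ultimately show ?thesis
    using group.pow_coprime_imp_one[OF H_group f_closed _ a] assms by blast
qed

lemma sylow_in_kernel:
  assumes "prime p" "prime q" "p \<noteq> q" "sylow_subgroup q D S" "x \<in> S"
  shows "f p x = \<one>\<^bsub>H p\<^esub>"
proof -
  have "x \<in> carrier D"
    using assms by (auto simp: sylow_subgroup_def subgroup.mem_carrier)
  then show ?thesis
    using prime_power_element_in_kernel assms D.sylow_subgroup_pow by blast
qed

text \<open>The intersection of the kernels of all other quotients embeds into the \<open>q\<close>-th quotient,
  so it is a \<open>q\<close>-group; it contains every Sylow \<open>q\<close>-subgroup, hence equals it.\<close>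

theorem sylow_unique:
  assumes q: "prime q"
  shows "\<exists>!S. sylow_subgroup q D S"
proof -
  define K where "K = {x \<in> carrier D. \<forall>p. prime p \<and> p \<noteq> q \<longrightarrow> f p x = \<one>\<^bsub>H p\<^esub>}"
  interpret fq: group_hom D "H q" "f q" using q by (rule f_group_hom)
  have K: "subgroup K D"
  proof (rule D.subgroupI)
    show "K \<subseteq> carrier D" by (auto simp: K_def)
    have "\<one> \<in> K" by (auto simp: K_def group_hom.hom_one[OF f_group_hom])
    then show "K \<noteq> {}" by blast
  next
    fix x y assume "x \<in> K" "y \<in> K"
    then show "x \<otimes> y \<in> K"
      by (auto simp: K_def hom_mult[OF f_hom] group.is_monoid[OF H_group] monoid.l_one monoid.one_closed)
  next
    fix x assume "x \<in> K"
    then show "inv x \<in> K"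
      by (auto simp: K_def group_hom.hom_inv[OF f_group_hom] group.is_monoid[OF H_group] monoid.inv_one)
  qed
  have finK: "finite K" using K fin by (meson finite_subset subgroup.subset)
  have "inj_on (f q) K"
  proof (rule inj_onI)
    fix x y assume xy: "x \<in> K" "y \<in> K" "f q x = f q y"
    then have c: "x \<otimes> inv y \<in> K" using K by (simp add: subgroup.m_closed subgroup.m_inv_closed)
    have xyc: "x \<in> carrier D" "y \<in> carrier D" using xy by (auto simp: K_def)
    have "f q (x \<otimes> inv y) = \<one>\<^bsub>H q\<^esub>"
      using xyc xy(3) by simp
    then have "x \<otimes> inv y = \<one>"
      using c faithful[of "x \<otimes> inv y"] by (auto simp: K_def)
    then show "x = y"
      using xyc D.inv_solve_right'[of "\<one>" x y] by simp
  qed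
  then have "card K = card (f q ` K)" by (simp add: card_image)
  moreover have "card (f q ` K) dvd order (H q)"
    using group.lagrange[OF H_group[OF q] fq.subgroup_img_is_subgroup[OF K]] by (metis dvd_triv_right)
  ultimately obtain b where b: "card K = q ^ b"
    using H_order[OF q] q divides_primepow_nat by metis
  have "card K dvd order D"
    using D.lagrange[OF K] by (metis dvd_triv_right)
  then have cardK: "card K dvd q ^ multiplicity q (order D)"
    using dvd_prime_part[OF order_pos q, of "card K" b] b by simp
  have eq: "S = K" if S: "sylow_subgroup q D S" for S
  proof -
    have "S \<subseteq> K"
      using S sylow_in_kernel[OF _ q _ S] subgroup.mem_carrier[of S D]
      by (auto simp: K_def sylow_subgroup_def)
    moreover have "card K \<le> card S"
      using cardK S q by (auto simp: sylow_subgroup_def dvd_imp_le prime_gt_0_nat)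
    ultimately show ?thesis
      using finK by (simp add: card_seteq)
  qed
  obtain S where "sylow_subgroup q D S"
    using D.sylow_subgroup_exists[OF fin q] .
  then show ?thesis using eq by blast
qed

end

section \<open>Finite nilpotent groups\<close>

context group
begin

lemma mult_inv_cancel_left: "\<lbrakk>x \<in> carrier G; z \<in> carrier G\<rbrakk> \<Longrightarrow> inv x \<otimes> (x \<otimes> z) = z"
  by (simp add: m_assoc[symmetric])

lemma mult_cancel_inv_left: "\<lbrakk>x \<in> carrier G; z \<in> carrier G\<rbrakk> \<Longrightarrow> x \<otimes> (inv x \<otimes> z) = z"
  by (simp add: m_assoc[symmetric])

lemmas inv_cancel = mult_inv_cancel_left mult_cancel_inv_left

lemma card_subgroup_dvd_card:
  assumes H: "subgroup H G" and K: "subgroup K G" and HK: "H \<subseteq> K"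
  shows "card H dvd card K"
proof -
  have sub: "subgroup H (G\<lparr>carrier := K\<rparr>)" using assms by (rule subgroup_incl)
  have "card H dvd order (G\<lparr>carrier := K\<rparr>)"
    unfolding group.lagrange[OF subgroup_imp_group[OF K] sub, symmetric] by simp
  then show ?thesis by (simp add: order_def)
qed

lemma mem_normalizer_iff:
  assumes "subgroup H G"
  shows "x \<in> normalizer G H \<longleftrightarrow>
    x \<in> carrier G \<and> (\<forall>h \<in> H. x \<otimes> h \<otimes> inv x \<in> H \<and> inv x \<otimes> h \<otimes> x \<in> H)"
    (is "_ \<longleftrightarrow> ?rhs")
proof -
  have H: "H \<subseteq> carrier G" using assms by (rule subgroup.subset)
  have iff: "x \<in> normalizer G H \<longleftrightarrow> x \<in> carrier G \<and> (\<lambda>h. x \<otimes> h \<otimes> inv x) ` H = H"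
  proof -
    have "x <# H #> inv x = (\<lambda>h. x \<otimes> h \<otimes> inv x) ` H"
      by (auto simp: l_coset_def r_coset_def)
    then show ?thesis using H by (auto simp: normalizer_def stabilizer_def)
  qed
  show ?thesis
  proof
    assume "x \<in> normalizer G H"
    then have x: "x \<in> carrier G" "(\<lambda>h. x \<otimes> h \<otimes> inv x) ` H = H" using iff by auto
    have "inv x \<otimes> h \<otimes> x \<in> H" if h: "h \<in> H" for h
    proof -
      obtain k where k: "k \<in> H" "h = x \<otimes> k \<otimes> inv x" using h x(2) by blast
      then have "k \<in> carrier G" using H by blast
      then have "inv x \<otimes> h \<otimes> x = k" using x(1) k(2) by (simp add: m_assoc inv_cancel)
      then show ?thesis using k(1) by simp
    qed
    then show ?rhs using x by blast
  next
    assume r: ?rhs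
    have "h \<in> (\<lambda>h. x \<otimes> h \<otimes> inv x) ` H" if h: "h \<in> H" for h
    proof (rule image_eqI)
      have "h \<in> carrier G" using h H by blast
      then show "h = x \<otimes> (inv x \<otimes> h \<otimes> x) \<otimes> inv x" using r by (simp add: m_assoc inv_cancel)
      show "inv x \<otimes> h \<otimes> x \<in> H" using r h by blast
    qed
    moreover have "(\<lambda>h. x \<otimes> h \<otimes> inv x) ` H \<subseteq> H" using r by blast
    ultimately show "x \<in> normalizer G H" using r iff by (meson subsetI subset_antisym)
  qed
qed

lemma subgroup_normalizer: "subgroup H G \<Longrightarrow> subgroup (normalizer G H) G"
  by (simp add: normalizer_imp_subgroup subgroup.subset)

lemma normal_in_normalizer:
  assumes "subgroup H G"
  shows "H \<lhd> G\<lparr>carrier := normalizer G H\<rparr>"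
proof -
  have N: "subgroup (normalizer G H) G" using assms by (rule subgroup_normalizer)
  interpret N: group "G\<lparr>carrier := normalizer G H\<rparr>" using N by (rule subgroup_imp_group)
  have "H \<subseteq> normalizer G H"
    using assms
    by (auto simp: mem_normalizer_iff subgroup.mem_carrier subgroup.m_closed subgroup.m_inv_closed)
  then have "subgroup H (G\<lparr>carrier := normalizer G H\<rparr>)"
    using assms N by (simp add: subgroup_incl)
  then show ?thesis
    using assms N by (auto simp: N.normal_inv_iff mem_normalizer_iff m_inv_consistent)
qed

lemma pow_conjugate:
  assumes "x \<in> carrier G" "h \<in> carrier G"
  shows "(x \<otimes> h \<otimes> inv x) [^] (n::nat) = x \<otimes> h [^] n \<otimes> inv x"
proof (induction n)
  case (Suc n)
  have "(x \<otimes> h \<otimes> inv x) [^] Suc n = x \<otimes> h [^] n \<otimes> inv x \<otimes> (x \<otimes> h \<otimes> inv x)"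
    by (simp only: nat_pow_Suc Suc)
  then show ?case using assms by (simp add: m_assoc inv_cancel)
qed (use assms in simp)

text \<open>The image of \<open>x\<close> in the quotient has an order that divides both \<open>k\<close> and the index.\<close>

lemma mem_normal_of_coprime_index:
  assumes N: "N \<lhd> G" and x: "x \<in> carrier G" "x [^] (k::nat) = \<one>"
    and "coprime k (card (rcosets N))"
  shows "x \<in> N"
proof -
  interpret N: normal N G by fact
  interpret Q: group "G Mod N" by (rule N.factorgroup_is_group)
  have c: "N #> x \<in> carrier (G Mod N)" using x by (auto simp: carrier_FactGroup)
  have "(N #> x) [^]\<^bsub>G Mod N\<^esub> k = \<one>\<^bsub>G Mod N\<^esub>"
    using x by (simp add: N.FactGroup_pow N.subset)
  moreover have "(N #> x) [^]\<^bsub>G Mod N\<^esub> card (rcosets N) = \<one>\<^bsub>G Mod N\<^esub>"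
    using Q.pow_order_eq_1[OF c] by (simp add: order_def FactGroup_def)
  ultimately have "N #> x = \<one>\<^bsub>G Mod N\<^esub>"
    using Q.pow_coprime_imp_one c assms(4) by blast
  then show ?thesis
    using x N.is_subgroup by (metis coset_join1 one_FactGroup)
qed

lemma mem_normal_sylow:
  assumes fin: "finite (carrier G)" and p: "prime p" and P: "P \<lhd> G"
    and card: "card P = p ^ multiplicity p (order G)"
    and x: "x \<in> carrier G" "x [^] (p ^ a) = \<one>"
  shows "x \<in> P"
proof (rule mem_normal_of_coprime_index[OF P x])
  have n: "order G \<noteq> 0" using fin order_gt_0_iff_finite by auto
  have "order G = p ^ multiplicity p (order G) * card (rcosets P)"
    using lagrange[OF normal_imp_subgroup[OF P]] card by (simp add: mult.commute)
  then have "\<not> p dvd card (rcosets P)"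
    using power_dvd_iff_le_multiplicity[of "order G" p "Suc (multiplicity p (order G))"] n p
    by (metis Suc_n_not_le_n dvd_triv_left mult_dvd_mono dvd_refl not_prime_unit power_Suc2)
  then show "coprime (p ^ a) (card (rcosets P))"
    using p by (simp add: prime_imp_coprime)
qed

end

locale finite_nilpotent_group = group G for G (structure) +
  assumes fin: "finite (carrier G)"
    and nilpotent: "nilpotent_group G"
begin

lemma order_nonzero: "0 < order G"
  using fin order_gt_0_iff_finite by blast

lemma subgroup_lower_central_series: "subgroup (lower_central_series G n) G"
proof (induction n)
  case (Suc n)
  then show ?case
    by (auto intro!: generate_is_subgroup dest: subgroup.mem_carrier)
qed (simp add: subgroup_self)

lemma commutator_in_lower_central_series:
  "\<lbrakk>x \<in> lower_central_series G n; y \<in> carrier G\<rbrakk> \<Longrightarrow>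
    x \<otimes> y \<otimes> inv x \<otimes> inv y \<in> lower_central_series G (Suc n)"
  by (auto intro: generate.incl)

text \<open>The last term of the lower central series whose intersection with \<open>K\<close> is not contained in \<open>H\<close>
  provides such an element: its commutators with \<open>H\<close> lie in the next term and in \<open>K\<close>, hence
  in \<open>H\<close>.\<close>

lemma normalizer_grows:
  assumes H: "subgroup H G" and K: "subgroup K G" and proper: "H \<subset> K"
  obtains x where "x \<in> K" "x \<in> normalizer G H" "x \<notin> H"
proof -
  obtain n where n: "lower_central_series G n = {\<one>}"
    using nilpotent by (auto simp: nilpotent_group_def)
  define m where "m = (LEAST m. lower_central_series G m \<inter> K \<subseteq> H)"
  have m: "lower_central_series G m \<inter> K \<subseteq> H"
    unfolding m_def by (rule LeastI[of _ n]) (use n H in \<open>auto simp: subgroup.one_closed\<close>)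
  have "m \<noteq> 0"
  proof
    assume "m = 0"
    then have "K \<subseteq> H" using m subgroup.subset[OF K] by auto
    then show False using proper by blast
  qed
  then obtain k where k: "m = Suc k" using not0_implies_Suc by blast
  have "\<not> lower_central_series G k \<inter> K \<subseteq> H"
    using not_less_Least[of k "\<lambda>m. lower_central_series G m \<inter> K \<subseteq> H"] k
    unfolding m_def[symmetric] by simp
  then obtain x where x: "x \<in> lower_central_series G k" "x \<in> K" "x \<notin> H" by blast
  have conj: "y \<otimes> h \<otimes> inv y \<in> H"
    if y: "y \<in> lower_central_series G k" "y \<in> K" and h: "h \<in> H" for y h
  proof -
    have hK: "h \<in> K" using h proper by blast
    have c: "y \<in> carrier G" "h \<in> carrier G"
      using y hK K by (auto dest: subgroup.mem_carrier)
    have "y \<otimes> h \<otimes> inv y \<otimes> inv h \<in> K"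
      using y hK K by (simp add: subgroup.m_closed subgroup.m_inv_closed)
    then have "y \<otimes> h \<otimes> inv y \<otimes> inv h \<in> H"
      using commutator_in_lower_central_series[OF y(1) c(2)] m k by auto
    then have "y \<otimes> h \<otimes> inv y \<otimes> inv h \<otimes> h \<in> H"
      by (rule subgroup.m_closed[OF H _ h])
    then show ?thesis using c by (simp add: m_assoc)
  qed
  have "inv x \<in> lower_central_series G k" "inv x \<in> K"
    using x subgroup_lower_central_series[of k] K by (simp_all add: subgroup.m_inv_closed)
  moreover have xc: "x \<in> carrier G"
    using x K by (simp add: subgroup.mem_carrier)
  ultimately have "x \<in> normalizer G H"
    using conj[OF x(1,2)] conj[of "inv x"] xc by (simp add: mem_normalizer_iff[OF H])
  then show thesis using x that by blast
qed

text \<open>A Sylow subgroup \<open>P\<close> consists of all elements of \<open>p\<close>-power order in its normalizer \<open>N\<close>, so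
  everything that normalizes \<open>N\<close> normalizes \<open>P\<close>. As normalizers grow, \<open>N\<close> is the whole group.\<close>

lemma sylow_normal:
  assumes p: "prime p" and P: "sylow_subgroup p G P"
  shows "P \<lhd> G"
proof -
  let ?N = "normalizer G P"
  have sub: "subgroup P G" and card: "card P = p ^ multiplicity p (order G)"
    using P by (auto simp: sylow_subgroup_def)
  have N: "subgroup ?N G" using sub by (rule subgroup_normalizer)
  have PN: "P \<lhd> G\<lparr>carrier := ?N\<rparr>" using sub by (rule normal_in_normalizer)
  interpret N: group "G\<lparr>carrier := ?N\<rparr>" using N by (rule subgroup_imp_group)
  have finN: "finite ?N" using N fin by (meson finite_subset subgroup.subset)
  have cardN: "card P = p ^ multiplicity p (order (G\<lparr>carrier := ?N\<rparr>))"
  proof -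
    have "card P dvd card ?N"
      using card_subgroup_dvd_card[OF sub N] subgroup.subset[OF normal_imp_subgroup[OF PN]] by simp
    moreover have "card ?N dvd order G"
      unfolding lagrange[OF N, symmetric] by simp
    ultimately have "multiplicity p (card ?N) = multiplicity p (order G)"
      using card p order_nonzero dvd_imp_multiplicity_le[of "card ?N" "order G" p]
        power_dvd_iff_le_multiplicity[of "card ?N" p "multiplicity p (order G)"]
      by (metis dvd_0_left_iff le_antisym neq0_conv not_prime_unit)
    then show ?thesis using card by (simp add: order_def)
  qed
  have char: "y \<in> P" if "y \<in> ?N" "y [^] (p ^ multiplicity p (order G)) = \<one>" for y
    using N.mem_normal_sylow[OF _ p PN cardN, of y "multiplicity p (order G)"] finN that
    by (simp add: nat_pow_consistent[symmetric])
  have "?N = carrier G"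
  proof (rule ccontr)
    assume "?N \<noteq> carrier G"
    then obtain x where x: "x \<in> normalizer G ?N" "x \<notin> ?N"
      using normalizer_grows[OF N subgroup_self] subgroup.subset[OF N] by blast
    have xN: "x \<in> carrier G" "\<And>y. y \<in> ?N \<Longrightarrow> x \<otimes> y \<otimes> inv x \<in> ?N \<and> inv x \<otimes> y \<otimes> x \<in> ?N"
      using x(1) mem_normalizer_iff[OF N] by auto
    have conj: "z \<otimes> h \<otimes> inv z \<in> P"
      if z: "z \<in> carrier G" "z \<otimes> h \<otimes> inv z \<in> ?N" and h: "h \<in> P" for z h
    proof (rule char[OF z(2)])
      have "h \<in> carrier G" using h sub by (meson subgroup.mem_carrier)
      then show "(z \<otimes> h \<otimes> inv z) [^] (p ^ multiplicity p (order G)) = \<one>"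
        using sylow_subgroup_pow[OF P h] z(1) by (simp add: pow_conjugate)
    qed
    have PsubN: "P \<subseteq> ?N" using subgroup.subset[OF normal_imp_subgroup[OF PN]] by simp
    have "x \<in> ?N"
      unfolding mem_normalizer_iff[OF sub]
      using xN conj[of x] conj[of "inv x"] PsubN by auto
    then show False using x(2) by simp
  qed
  then show ?thesis
    using mem_normalizer_iff[OF sub] sub by (auto simp: normal_inv_iff)
qed

lemma sylow_subgroup_iff:
  assumes p: "prime p"
  shows "sylow_subgroup p G P \<longleftrightarrow> P = {x \<in> carrier G. x [^] (p ^ multiplicity p (order G)) = \<one>}"
proof -
  have eq: "P = {x \<in> carrier G. x [^] (p ^ multiplicity p (order G)) = \<one>}"
    if P: "sylow_subgroup p G P" for P
    using sylow_subgroup_pow[OF P] mem_normal_sylow[OF fin p sylow_normal[OF p P]] P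
    by (auto simp: sylow_subgroup_def dest: subgroup.mem_carrier)
  obtain S where "sylow_subgroup p G S"
    using sylow_subgroup_exists[OF fin p] .
  then show ?thesis using eq by metis
qed

lemma sylow_the_sylow: "prime p \<Longrightarrow> sylow_subgroup p G (the_sylow G p)"
  unfolding the_sylow_def by (rule theI') (simp add: sylow_subgroup_iff)

lemma the_sylow_eq:
  "prime p \<Longrightarrow> the_sylow G p = {x \<in> carrier G. x [^] (p ^ multiplicity p (order G)) = \<one>}"
  using sylow_the_sylow sylow_subgroup_iff by blast

lemma the_sylow_normal: "prime p \<Longrightarrow> the_sylow G p \<lhd> G"
  using sylow_normal sylow_the_sylow by blast

lemma subgroup_the_sylow: "prime p \<Longrightarrow> subgroup (the_sylow G p) G"
  using the_sylow_normal normal_imp_subgroup by blast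

lemma the_sylow_closed: "\<lbrakk>prime p; x \<in> the_sylow G p\<rbrakk> \<Longrightarrow> x \<in> carrier G"
  by (rule subgroup.mem_carrier[OF subgroup_the_sylow])

lemma card_the_sylow: "prime p \<Longrightarrow> card (the_sylow G p) = p ^ multiplicity p (order G)"
  using sylow_the_sylow by (simp add: sylow_subgroup_def)

lemma the_sylow_pow:
  "\<lbrakk>prime p; x \<in> the_sylow G p\<rbrakk> \<Longrightarrow> x [^] (p ^ multiplicity p (order G)) = \<one>"
  by (simp add: the_sylow_eq)

definition sylow_complement :: "nat \<Rightarrow> 'a set" where
  "sylow_complement p = generate G (\<Union>q \<in> {q. prime q \<and> q \<noteq> p}. the_sylow G q)"

lemma subgroup_sylow_complement: "subgroup (sylow_complement p) G"
  unfolding sylow_complement_def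
  by (rule generate_is_subgroup) (auto simp: the_sylow_closed)

lemma sylow_complement_closed: "x \<in> sylow_complement p \<Longrightarrow> x \<in> carrier G"
  by (rule subgroup.mem_carrier[OF subgroup_sylow_complement])

lemma the_sylow_subset_complement:
  "\<lbrakk>prime q; q \<noteq> p\<rbrakk> \<Longrightarrow> the_sylow G q \<subseteq> sylow_complement p"
  unfolding sylow_complement_def by (auto intro: generate.incl)

lemma the_sylow_commute:
  assumes "prime p" "prime q" "p \<noteq> q" "x \<in> the_sylow G p" "y \<in> the_sylow G q"
  shows "x \<otimes> y = y \<otimes> x"
proof (rule normal_imp_commuting)
  show "the_sylow G p \<lhd> G" "the_sylow G q \<lhd> G" using assms the_sylow_normal by auto
  show "the_sylow G p \<inter> the_sylow G q \<subseteq> {\<one>}"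
  proof
    fix z assume z: "z \<in> the_sylow G p \<inter> the_sylow G q"
    have "coprime (p ^ multiplicity p (order G)) (q ^ multiplicity q (order G))"
      using assms by (simp add: primes_coprime)
    then show "z \<in> {\<one>}"
      using z assms pow_coprime_imp_one[of z] by (auto simp: the_sylow_eq)
  qed
qed (use assms in auto)

lemma sylow_commutes_with_complement:
  assumes p: "prime p" and x: "x \<in> the_sylow G p" and y: "y \<in> sylow_complement p"
  shows "x \<otimes> y = y \<otimes> x"
  using y unfolding sylow_complement_def
proof (induction rule: generate.induct)
  case one
  then show ?case using x p the_sylow_closed by simp
next
  case (incl h)
  then show ?case using the_sylow_commute p x by auto
next
  case (inv h)
  then obtain q where "prime q" "q \<noteq> p" "inv h \<in> the_sylow G q"
    by (auto dest: subgroup.m_inv_closed[OF subgroup_the_sylow])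
  then show ?case using the_sylow_commute p x by auto
next
  case (eng h k)
  then have "h \<in> carrier G" "k \<in> carrier G" "x \<in> carrier G"
    using the_sylow_closed[OF p x] by (auto intro: sylow_complement_closed[unfolded sylow_complement_def])
  then show ?case using eng by (metis m_assoc)
qed

text \<open>Among the normal subgroups without elements of order \<open>p\<close>, a maximal one contains all Sylow
  subgroups for other primes, since the product of two such subgroups is again one.\<close>

lemma ord_sylow_complement:
  assumes p: "prime p" and y: "y \<in> sylow_complement p"
  shows "coprime (ord y) p"
proof -
  define \<M> where "\<M> = {M. M \<lhd> G \<and> (\<forall>x \<in> M. coprime (ord x) p)}"
  have "finite \<M>"
    using fin by (auto simp: \<M>_def dest!: normal_imp_subgroup subgroup.subset
        intro: finite_subset[of _ "Pow (carrier G)"])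
  moreover have "{\<one>} \<in> \<M>" by (simp add: \<M>_def one_is_normal)
  ultimately obtain M where M: "M \<in> \<M>" and max: "\<And>K. \<lbrakk>K \<in> \<M>; M \<subseteq> K\<rbrakk> \<Longrightarrow> M = K"
    using finite_has_maximal[of \<M>] by blast
  interpret M: normal M G using M by (simp add: \<M>_def)
  have "the_sylow G q \<subseteq> M" if q: "prime q" "q \<noteq> p" for q
  proof -
    let ?S = "the_sylow G q" and ?k = "q ^ multiplicity q (order G)"
    have "M <#> ?S \<in> \<M>"
      unfolding \<M>_def
    proof (intro CollectI conjI ballI)
      show "M <#> ?S \<lhd> G"
        using normal_subgroup_set_mult_closed M.normal_axioms the_sylow_normal q by blast
      fix x assume "x \<in> M <#> ?S"
      then obtain m s where ms: "m \<in> M" "s \<in> ?S" "x = m \<otimes> s"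
        by (auto simp: set_mult_def)
      then have c: "s \<in> carrier G" "x \<in> carrier G" using the_sylow_closed q by auto
      then have "M #> x = M #> s"
        using ms by (metis M.rcos_const M.subset coset_mult_assoc is_group M.mem_carrier)
      then have "M #> x [^] ?k = M #> s [^] ?k"
        using M.FactGroup_pow c by metis
      also have "\<dots> = M"
        using the_sylow_pow q ms M.subset by simp
      finally have "x [^] ?k \<in> M"
        using coset_join1[OF _ nat_pow_closed[OF c(2)] M.is_subgroup] by blast
      then have cop: "coprime (ord (x [^] ?k)) p"
        using M by (auto simp: \<M>_def)
      have "x [^] (?k * ord (x [^] ?k)) = \<one>"
        using c by (simp add: nat_pow_pow[symmetric])
      then have "ord x dvd ?k * ord (x [^] ?k)"
        using c pow_eq_id by blast
      moreover have "coprime (?k * ord (x [^] ?k)) p"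
        using cop q p by (simp add: primes_coprime)
      ultimately show "coprime (ord x) p"
        by (rule coprime_divisors[OF _ dvd_refl])
    qed
    moreover have "M \<subseteq> M <#> ?S"
    proof
      fix m assume "m \<in> M"
      then show "m \<in> M <#> ?S"
        using subgroup.one_closed[OF subgroup_the_sylow[OF q(1)]]
        unfolding set_mult_def by (intro UN_I[of m] UN_I[of \<one>]) auto
    qed
    ultimately have "M = M <#> ?S" using max by blast
    moreover have "?S \<subseteq> M <#> ?S"
    proof
      fix s assume "s \<in> ?S"
      then show "s \<in> M <#> ?S"
        using M.one_closed the_sylow_closed[OF q(1)] unfolding set_mult_def
        by (intro UN_I[of \<one>] UN_I[of s]) auto
    qed
    ultimately show ?thesis by blast
  qed
  then have "sylow_complement p \<subseteq> M"
    unfolding sylow_complement_def by (intro generate_subgroup_incl M.is_subgroup) blast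
  then show ?thesis using y M by (auto simp: \<M>_def)
qed

definition primary :: "nat \<Rightarrow> 'a \<Rightarrow> 'a" where
  "primary p x = x [^] primary_exponent (order G) p"

lemma primary_closed [simp]: "x \<in> carrier G \<Longrightarrow> primary p x \<in> carrier G"
  by (simp add: primary_def)

lemma primary_mem_subgroup: "\<lbrakk>subgroup H G; x \<in> H\<rbrakk> \<Longrightarrow> primary p x \<in> H"
  by (simp add: primary_def subgroup_pow_closed)

lemma primary_in_sylow: "\<lbrakk>prime p; x \<in> carrier G\<rbrakk> \<Longrightarrow> primary p x \<in> the_sylow G p"
  using primary_exponent_prime_power[OF _ order_nonzero]
  by (simp add: the_sylow_eq primary_def pow_order_eq_1)

lemma primary_sylow: "\<lbrakk>prime p; x \<in> the_sylow G p\<rbrakk> \<Longrightarrow> primary p x = x"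
  using primary_exponent_fixes[OF the_sylow_closed order_nonzero _ _ the_sylow_pow]
  by (simp add: primary_def pow_order_eq_1 the_sylow_closed)

lemma primary_complement: "\<lbrakk>prime p; x \<in> sylow_complement p\<rbrakk> \<Longrightarrow> primary p x = \<one>"
  using primary_exponent_kills[OF _ order_nonzero, of x p "ord x"] sylow_complement_closed[of x p]
    ord_sylow_complement
  by (simp add: primary_def pow_order_eq_1)

lemma mem_subgroup_if_primary:
  "\<lbrakk>subgroup H G; x \<in> carrier G; \<And>p. prime p \<Longrightarrow> primary p x \<in> H\<rbrakk> \<Longrightarrow> x \<in> H"
  using mem_subgroup_if_primary_parts[OF fin] by (simp add: primary_def)

text \<open>The element \<open>inv (primary p x) \<otimes> x\<close> has trivial \<open>p\<close>-part, and its other primary parts lie in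
  Sylow subgroups that generate the complement.\<close>

lemma complement_part:
  assumes p: "prime p" and x: "x \<in> carrier G"
  shows "inv (primary p x) \<otimes> x \<in> sylow_complement p"
proof (rule mem_subgroup_if_primary[OF subgroup_sylow_complement])
  let ?e = "primary_exponent (order G) p"
  show "inv (primary p x) \<otimes> x \<in> carrier G" using x by simp
  fix q :: nat assume q: "prime q"
  show "primary q (inv (primary p x) \<otimes> x) \<in> sylow_complement p"
  proof (cases "q = p")
    case False
    then show ?thesis
      using primary_in_sylow[OF q] the_sylow_subset_complement[OF q False] x by auto
  next
    case True
    have "x \<otimes> primary p x = primary p x \<otimes> x"
      using x nat_pow_comm[of x 1 ?e] by (simp add: primary_def)
    then have "inv (primary p x) \<otimes> (x \<otimes> primary p x) = x"
      using x by (simp add: m_assoc[symmetric])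
    then have comm: "inv (primary p x) \<otimes> x = x \<otimes> inv (primary p x)"
      using x by (simp add: inv_solve_right m_assoc)
    have "primary p (inv (primary p x) \<otimes> x) = inv (primary p x) [^] ?e \<otimes> x [^] ?e"
      unfolding primary_def[of p "inv (primary p x) \<otimes> x"]
      by (rule pow_mult_distrib[OF comm]) (use x in auto)
    also have "\<dots> = inv (primary p (primary p x)) \<otimes> primary p x"
      using x by (simp add: primary_def nat_pow_inv)
    also have "\<dots> = \<one>"
      using x p by (simp add: primary_sylow primary_in_sylow)
    finally show ?thesis
      using True subgroup_sylow_complement by (simp add: subgroup.one_closed)
  qed
qed

text \<open>A power map need not be a homomorphism. This one is, since it is the identity on the Sylow
  subgroup, trivial on the complement, and these two subgroups commute elementwise and
  generate the group.\<close>

lemma primary_mult: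
  assumes p: "prime p" and x: "x \<in> carrier G" and y: "y \<in> carrier G"
  shows "primary p (x \<otimes> y) = primary p x \<otimes> primary p y"
proof -
  let ?e = "primary_exponent (order G) p"
  define a b c d where "a = primary p x" "b = inv (primary p x) \<otimes> x"
    "c = primary p y" "d = inv (primary p y) \<otimes> y"
  note defs = this
  have a: "a \<in> the_sylow G p" "c \<in> the_sylow G p"
    using p x y by (simp_all add: defs primary_in_sylow)
  have b: "b \<in> sylow_complement p" "d \<in> sylow_complement p"
    using p x y by (simp_all add: defs complement_part)
  have car: "a \<in> carrier G" "b \<in> carrier G" "c \<in> carrier G" "d \<in> carrier G"
    using a b the_sylow_closed[OF p] by (auto intro: sylow_complement_closed)
  have xy: "x = a \<otimes> b" "y = c \<otimes> d"
    using x y by (simp_all add: defs inv_solve_left m_assoc[symmetric])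
  have bc: "c \<otimes> b = b \<otimes> c"
    using sylow_commutes_with_complement p a b by blast
  have "x \<otimes> y = a \<otimes> (b \<otimes> c) \<otimes> d"
    unfolding xy using car by (simp add: m_assoc)
  also have "\<dots> = (a \<otimes> c) \<otimes> (b \<otimes> d)"
    unfolding bc[symmetric] using car by (simp add: m_assoc)
  finally have eq: "x \<otimes> y = (a \<otimes> c) \<otimes> (b \<otimes> d)" .
  have ac: "a \<otimes> c \<in> the_sylow G p" and bd: "b \<otimes> d \<in> sylow_complement p"
    using a b p subgroup_the_sylow subgroup_sylow_complement by (auto simp: subgroup.m_closed)
  have "primary p (x \<otimes> y) = primary p (a \<otimes> c) \<otimes> primary p (b \<otimes> d)"
    unfolding eq primary_def
    using pow_mult_distrib[OF sylow_commutes_with_complement[OF p ac bd]] car by simp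
  also have "\<dots> = a \<otimes> c"
    using ac bd p car by (simp add: primary_sylow primary_complement)
  finally show ?thesis by (simp add: defs)
qed

lemma primary_hom: "prime p \<Longrightarrow> primary p \<in> hom G G"
  by (rule homI) (auto simp: primary_mult)

lemma primary_group_hom: "prime p \<Longrightarrow> group_hom G G (primary p)"
  by (simp add: group_hom_def group_hom_axioms_def primary_hom)

lemma primary_inv: "\<lbrakk>prime p; x \<in> carrier G\<rbrakk> \<Longrightarrow> primary p (inv x) = inv (primary p x)"
  using group_hom.hom_inv[OF primary_group_hom] by blast

end

section \<open>Groups of prime power order acting on finite sets\<close>

text \<open>The orbits of size greater than \<open>1\<close> have sizes divisible by \<open>q\<close>.\<close>

lemma card_fixed_points:
  assumes H: "group H" "order H = q ^ k" and q: "prime q" and E: "finite E"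
    and closed: "\<And>a x. \<lbrakk>a \<in> carrier H; x \<in> E\<rbrakk> \<Longrightarrow> f a x \<in> E"
    and one: "\<And>x. x \<in> E \<Longrightarrow> f \<one>\<^bsub>H\<^esub> x = x"
    and mult: "\<And>a b x. \<lbrakk>a \<in> carrier H; b \<in> carrier H; x \<in> E\<rbrakk> \<Longrightarrow> f (a \<otimes>\<^bsub>H\<^esub> b) x = f a (f b x)"
  shows "[card {x \<in> E. \<forall>a \<in> carrier H. f a x = x} = card E] (mod q)"
proof -
  interpret H: group H by fact
  define \<phi> where "\<phi> = (\<lambda>a. restrict (f a) E)"
  have inv: "f (inv\<^bsub>H\<^esub> a) (f a x) = x" "f a (f (inv\<^bsub>H\<^esub> a) x) = x" if "a \<in> carrier H" "x \<in> E" for a x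
    using that mult[symmetric] one by simp_all
  have Bij: "\<phi> a \<in> Bij E" if "a \<in> carrier H" for a
  proof -
    have "bij_betw (f a) E E"
      using that by (intro bij_betwI[of _ _ _ "f (inv\<^bsub>H\<^esub> a)"]) (auto simp: closed inv)
    then show ?thesis
      by (simp add: \<phi>_def Bij_def)
  qed
  have "\<phi> \<in> hom H (BijGroup E)"
    by (rule homI) (auto simp: BijGroup_def Bij, auto simp: \<phi>_def compose_def fun_eq_iff mult closed)
  then interpret group_action H E \<phi>
    by (simp add: group_action_def group_hom_def group_hom_axioms_def H group_BijGroup)
  let ?O = "orbits H E \<phi>" and ?Fix = "{x \<in> E. \<forall>a \<in> carrier H. f a x = x}"
  have orbit: "orbit H \<phi> x = {f a x | a. a \<in> carrier H}" if "x \<in> E" for x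
    using that by (auto simp: orbit_def \<phi>_def)
  have orbit_one: "card (orbit H \<phi> x) = 1 \<longleftrightarrow> x \<in> ?Fix" if x: "x \<in> E" for x
  proof
    assume "card (orbit H \<phi> x) = 1"
    then obtain y where y: "orbit H \<phi> x = {y}" using card_1_singletonE by blast
    have "f a x = y" if "a \<in> carrier H" for a using that y orbit[OF x] by auto
    then have "f a x = x" if "a \<in> carrier H" for a using that one[OF x] by (metis H.one_closed)
    then show "x \<in> ?Fix" using x by blast
  next
    assume "x \<in> ?Fix"
    then have "orbit H \<phi> x = {x}" using orbit[OF x] by (auto intro: exI[of _ "\<one>\<^bsub>H\<^esub>"])
    then show "card (orbit H \<phi> x) = 1" by simp
  qed
  have finO: "finite ?O" using E by (simp add: orbits_def)
  have "card E = (\<Sum>x\<in>E. 1)" by simp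
  also have "\<dots> = (\<Sum>orb\<in>?O. \<Sum>x\<in>orb. 1)" using disjoint_sum[OF E] by metis
  also have "\<dots> = (\<Sum>orb\<in>?O. card orb)" by simp
  also have "\<dots> = (\<Sum>orb\<in>{orb \<in> ?O. card orb = 1}. card orb) + (\<Sum>orb\<in>{orb \<in> ?O. card orb \<noteq> 1}. card orb)"
    using finO by (subst sum.union_disjoint[symmetric]) (auto intro!: sum.cong)
  also have "(\<Sum>orb\<in>{orb \<in> ?O. card orb = 1}. card orb) = card {orb \<in> ?O. card orb = 1}"
    by simp
  also have "{orb \<in> ?O. card orb = 1} = (\<lambda>x. {x}) ` ?Fix"
  proof -
    have "orbit H \<phi> x = {x}" if "x \<in> ?Fix" for x
      using that orbit[of x] by (auto intro: exI[of _ "\<one>\<^bsub>H\<^esub>"])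
    then show ?thesis using orbit_one by (auto simp: orbits_def image_def)
  qed
  also have "card \<dots> = card ?Fix" by (simp add: card_image)
  finally have eq: "card E = card ?Fix + (\<Sum>orb\<in>{orb \<in> ?O. card orb \<noteq> 1}. card orb)" .
  have "q dvd card orb" if orb: "orb \<in> ?O" "card orb \<noteq> 1" for orb
  proof -
    obtain x where x: "x \<in> E" "orb = orbit H \<phi> x" using orb(1) by (auto simp: orbits_def)
    then have "card orb dvd q ^ k"
      using orbit_stabilizer_theorem[OF x(1)] H(2) by (metis dvd_triv_left)
    then obtain b where b: "card orb = q ^ b" using q divides_primepow_nat by blast
    then show ?thesis using orb(2) by (cases b) auto
  qed
  then have "q dvd (\<Sum>orb\<in>{orb \<in> ?O. card orb \<noteq> 1}. card orb)" by (intro dvd_sum) auto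
  then obtain m where "(\<Sum>orb\<in>{orb \<in> ?O. card orb \<noteq> 1}. card orb) = q * m" ..
  then show ?thesis unfolding eq by (simp add: cong_def)
qed

section \<open>Subgroups containing Sylow subgroups\<close>

context group
begin

lemma index_coprime_if_contains_sylow:
  assumes fin: "finite (carrier G)" and p: "prime p" and S: "sylow_subgroup p G S"
    and H: "subgroup H G" and SH: "S \<subseteq> H"
  shows "\<not> p dvd card (rcosets H)"
proof
  assume *: "p dvd card (rcosets H)"
  have "card S dvd card H"
    using card_subgroup_dvd_card[OF _ H SH] S by (simp add: sylow_subgroup_def)
  then have "p ^ multiplicity p (order G) dvd card H"
    using S by (simp add: sylow_subgroup_def)
  then have "p ^ Suc (multiplicity p (order G)) dvd order G"
    using * lagrange[OF H] by (metis mult_dvd_mono power_Suc)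
  moreover have "order G \<noteq> 0" "\<not> is_unit p" using fin order_gt_0_iff_finite p not_prime_unit by auto
  ultimately show False using multiplicity_geI Suc_n_not_le_n by blast
qed

end

lemma prime_power_if_no_other_prime:
  fixes n p :: nat
  assumes "0 < n" "prime p" "\<And>q. \<lbrakk>prime q; q \<noteq> p\<rbrakk> \<Longrightarrow> \<not> q dvd n"
  shows "\<exists>a. n = p ^ a"
proof -
  let ?m = "n div p ^ multiplicity p n"
  have n: "n = p ^ multiplicity p n * ?m" by (simp add: multiplicity_dvd)
  have np: "\<not> p dvd ?m"
    using assms multiplicity_decompose[of n p] by (metis not_prime_unit neq0_conv)
  have "?m = 1"
  proof (rule ccontr)
    assume "?m \<noteq> 1"
    then obtain q where q: "prime q" "q dvd ?m" by (metis prime_factor_nat)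
    then have "q dvd n" using n by (metis dvd_mult)
    then show False using assms(3) q np by blast
  qed
  then show ?thesis using n by (metis mult.right_neutral)
qed

section \<open>A finite group acting on a finite nilpotent group\<close>

locale nilpotent_group_action =
  finite_nilpotent_group G + A: group A for G (structure) and A :: "('b, 'n) monoid_scheme" +
  fixes act :: "'b \<Rightarrow> 'a \<Rightarrow> 'a"
  assumes finA: "finite (carrier A)"
    and act_hom: "a \<in> carrier A \<Longrightarrow> act a \<in> hom G G"
    and act_one: "x \<in> carrier G \<Longrightarrow> act \<one>\<^bsub>A\<^esub> x = x"
    and act_act: "\<lbrakk>a \<in> carrier A; b \<in> carrier A; x \<in> carrier G\<rbrakk>
      \<Longrightarrow> act (a \<otimes>\<^bsub>A\<^esub> b) x = act a (act b x)"
begin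

lemma act_group_hom: "a \<in> carrier A \<Longrightarrow> group_hom G G (act a)"
  by (simp add: group_hom_def group_hom_axioms_def act_hom)

lemma act_closed [simp]: "\<lbrakk>a \<in> carrier A; x \<in> carrier G\<rbrakk> \<Longrightarrow> act a x \<in> carrier G"
  using group_hom.hom_closed[OF act_group_hom] by blast

lemma act_mult:
  "\<lbrakk>a \<in> carrier A; x \<in> carrier G; y \<in> carrier G\<rbrakk> \<Longrightarrow> act a (x \<otimes> y) = act a x \<otimes> act a y"
  by (rule hom_mult[OF act_hom])

lemma act_inv: "\<lbrakk>a \<in> carrier A; x \<in> carrier G\<rbrakk> \<Longrightarrow> act a (inv x) = inv (act a x)"
  using group_hom.hom_inv[OF act_group_hom] by blast

lemma act_one_right: "a \<in> carrier A \<Longrightarrow> act a \<one> = \<one>"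
  using group_hom.hom_one[OF act_group_hom] by blast

lemma act_pow: "\<lbrakk>a \<in> carrier A; x \<in> carrier G\<rbrakk> \<Longrightarrow> act a (x [^] (n::nat)) = act a x [^] n"
  using group_hom.hom_nat_pow[OF act_group_hom] by blast

lemma act_inverse:
  assumes "a \<in> carrier A" "x \<in> carrier G"
  shows "act (inv\<^bsub>A\<^esub> a) (act a x) = x" and "act a (act (inv\<^bsub>A\<^esub> a) x) = x"
  using assms act_act[symmetric] act_one by simp_all

lemma act_primary: "\<lbrakk>a \<in> carrier A; x \<in> carrier G\<rbrakk> \<Longrightarrow> act a (primary p x) = primary p (act a x)"
  by (simp add: primary_def act_pow)

lemma act_sylow: "\<lbrakk>prime p; a \<in> carrier A; x \<in> the_sylow G p\<rbrakk> \<Longrightarrow> act a x \<in> the_sylow G p"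
  by (auto simp: the_sylow_eq act_pow[symmetric] act_one_right)

definition invariant :: "'a set \<Rightarrow> bool" where
  "invariant H \<longleftrightarrow> subgroup H G \<and> (\<forall>a \<in> carrier A. \<forall>x \<in> H. act a x \<in> H)"

lemma invariantI:
  "\<lbrakk>subgroup H G; \<And>a x. \<lbrakk>a \<in> carrier A; x \<in> H\<rbrakk> \<Longrightarrow> act a x \<in> H\<rbrakk> \<Longrightarrow> invariant H"
  by (simp add: invariant_def)

lemma invariant_subgroup: "invariant H \<Longrightarrow> subgroup H G"
  by (simp add: invariant_def)

lemma invariant_act: "\<lbrakk>invariant H; a \<in> carrier A; x \<in> H\<rbrakk> \<Longrightarrow> act a x \<in> H"
  by (simp add: invariant_def)

lemma invariant_Int: "\<lbrakk>invariant H; invariant K\<rbrakk> \<Longrightarrow> invariant (H \<inter> K)"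
  by (simp add: invariant_def subgroups_Inter_pair)

lemma invariant_sylow: "prime p \<Longrightarrow> invariant (the_sylow G p)"
  by (simp add: invariant_def subgroup_the_sylow act_sylow)

lemma act_image_invariant:
  assumes H: "invariant H" and a: "a \<in> carrier A"
  shows "act a ` H = H"
proof
  show "act a ` H \<subseteq> H" using assms invariant_act by blast
  show "H \<subseteq> act a ` H"
  proof
    fix x assume x: "x \<in> H"
    then have "x = act a (act (inv\<^bsub>A\<^esub> a) x)"
      using a H by (simp add: act_inverse subgroup.mem_carrier[OF invariant_subgroup])
    then show "x \<in> act a ` H"
      using H a x invariant_act by (metis A.inv_closed imageI)
  qed
qed

lemma act_image_coset:
  assumes H: "invariant H" and a: "a \<in> carrier A" and x: "x \<in> carrier G"
  shows "act a ` (H #> x) = H #> act a x"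
proof -
  have "act a ` (H #> x) = (\<lambda>h. act a h \<otimes> act a x) ` H"
    using subgroup.subset[OF invariant_subgroup[OF H]] a x
    by (force simp: r_coset_def act_mult)
  also have "\<dots> = H #> act a x"
    unfolding r_coset_def by (subst (2) act_image_invariant[OF H a, symmetric]) auto
  finally show ?thesis .
qed

lemma act_generate:
  assumes a: "a \<in> carrier A" and S: "S \<subseteq> carrier G"
    and closed: "\<And>x. x \<in> S \<Longrightarrow> act a x \<in> S" and x: "x \<in> generate G S"
  shows "act a x \<in> generate G S"
proof -
  have "act a x \<in> act a ` generate G S" using x by blast
  also have "\<dots> = generate G (act a ` S)"
    using group_hom.generate_img[OF act_group_hom[OF a] S] by (rule sym)
  also have "\<dots> \<subseteq> generate G S" using closed by (intro mono_generate) auto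
  finally show ?thesis .
qed

subsection \<open>The commutator series of the action\<close>

primrec commutator_series :: "nat \<Rightarrow> 'a set" where
  "commutator_series 0 = carrier G"
| "commutator_series (Suc n) =
     generate G {act a x \<otimes> inv x | a x. a \<in> carrier A \<and> x \<in> commutator_series n}"

definition residual :: "'a set" where
  "residual = (\<Inter>n. commutator_series n)"

lemma commutators_invariant:
  assumes B: "B \<subseteq> carrier A" "\<And>a b. \<lbrakk>a \<in> carrier A; b \<in> B\<rbrakk> \<Longrightarrow> a \<otimes>\<^bsub>A\<^esub> b \<otimes>\<^bsub>A\<^esub> inv\<^bsub>A\<^esub> a \<in> B"
    and H: "invariant H"
  shows "invariant (generate G {act a x \<otimes> inv x | a x. a \<in> B \<and> x \<in> H})"
    (is "invariant (generate G ?S)")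
proof (rule invariantI)
  have HG: "\<And>x. x \<in> H \<Longrightarrow> x \<in> carrier G"
    using subgroup.mem_carrier[OF invariant_subgroup[OF H]] .
  have BA: "\<And>b. b \<in> B \<Longrightarrow> b \<in> carrier A" using B(1) by blast
  have S: "?S \<subseteq> carrier G" using HG BA by auto
  then show "subgroup (generate G ?S) G" by (rule generate_is_subgroup)
  fix a x assume a: "a \<in> carrier A" and "x \<in> generate G ?S"
  then show "act a x \<in> generate G ?S"
  proof (intro act_generate[OF a S])
    fix y assume "y \<in> ?S"
    then obtain b h where bh: "b \<in> B" "h \<in> H" "y = act b h \<otimes> inv h" by blast
    have "act a y = act (a \<otimes>\<^bsub>A\<^esub> b \<otimes>\<^bsub>A\<^esub> inv\<^bsub>A\<^esub> a) (act a h) \<otimes> inv (act a h)"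
      using a bh HG[OF bh(2)] BA[OF bh(1)]
      by (simp add: act_mult act_inv act_act act_inverse)
    moreover have "act a h \<in> H" using invariant_act H a bh by blast
    ultimately show "act a y \<in> ?S" using B(2)[OF a bh(1)] by blast
  qed
qed

lemma commutator_series_invariant: "invariant (commutator_series n)"
proof (induction n)
  case 0
  then show ?case by (simp add: invariant_def subgroup_self)
next
  case (Suc n)
  then show ?case using commutators_invariant[of "carrier A"] by simp
qed

lemma commutator_series_Suc_mono: "commutator_series (Suc n) \<subseteq> commutator_series n"
proof (induction n)
  case 0
  then show ?case using invariant_subgroup[OF commutator_series_invariant, of 1] subgroup.subset by simp
next
  case (Suc n)
  then have "{act a x \<otimes> inv x | a x. a \<in> carrier A \<and> x \<in> commutator_series (Suc n)}
      \<subseteq> {act a x \<otimes> inv x | a x. a \<in> carrier A \<and> x \<in> commutator_series n}"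
    by blast
  from mono_generate[OF this] show ?case by simp
qed

lemma commutator_series_antimono: "m \<le> n \<Longrightarrow> commutator_series n \<subseteq> commutator_series m"
  using lift_Suc_antimono_le[of commutator_series] commutator_series_Suc_mono by blast

lemma commutator_in_series:
  "\<lbrakk>a \<in> carrier A; x \<in> commutator_series n\<rbrakk> \<Longrightarrow> act a x \<otimes> inv x \<in> commutator_series (Suc n)"
  by (auto intro: generate.incl)

lemma residual_invariant: "invariant residual"
proof (rule invariantI)
  show "subgroup residual G"
    unfolding residual_def
    by (rule subgroups_Inter) (auto simp: invariant_subgroup[OF commutator_series_invariant])
  fix a x assume "a \<in> carrier A" "x \<in> residual"
  then show "act a x \<in> residual"
    unfolding residual_def by (auto intro: invariant_act[OF commutator_series_invariant])
qed

lemma subgroup_residual: "subgroup residual G"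
  using residual_invariant by (rule invariant_subgroup)

text \<open>By finiteness the series becomes stationary, and its last term is the residual.\<close>

lemma residual_generated:
  "residual = generate G {act a x \<otimes> inv x | a x. a \<in> carrier A \<and> x \<in> residual}"
proof -
  obtain N where N: "\<And>n. card (commutator_series N) \<le> card (commutator_series n)"
    using ex_has_least_nat[of "\<lambda>_. True" 0 "\<lambda>n. card (commutator_series n)"] by auto
  have fins: "finite (commutator_series n)" for n
    using fin subgroup.subset[OF invariant_subgroup[OF commutator_series_invariant]] finite_subset
    by blast
  have eq: "commutator_series n = commutator_series N" if "N \<le> n" for n
    using that commutator_series_antimono[OF that] N[of n] fins by (simp add: card_subset_eq le_antisym card_mono)
  have "commutator_series N \<subseteq> commutator_series n" for n
    using eq[of n] commutator_series_antimono[of n N] by (cases "N \<le> n") auto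
  then have L: "residual = commutator_series N" unfolding residual_def by blast
  show ?thesis
    using eq[of "Suc N"] unfolding L by simp
qed

subsection \<open>Elements of coprime order act trivially modulo the residual\<close>

text \<open>If \<open>l\<close> lies in the \<open>n\<close>-th term of the series, then the \<open>q\<close>-group \<open>S\<close> permutes the
  coset of the next term that contains \<open>l\<close>. For \<open>q \<noteq> p\<close> the size of this coset in the
  \<open>p\<close>-group \<open>the_sylow G p\<close> is prime to \<open>q\<close>, so the coset contains a fixed point, and \<open>l\<close> is
  the product of an element of the next term and this fixed point.\<close>

lemma fixed_point_decomposition:
  assumes p: "prime p" and q: "prime q" "q \<noteq> p"
    and S: "subgroup S A" "card S = q ^ k"
    and g: "g \<in> the_sylow G p"
  shows "\<exists>v c. v \<in> commutator_series n \<inter> the_sylow G p \<and> c \<in> the_sylow G p \<and>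
    g = v \<otimes> c \<and> (\<forall>s \<in> S. act s c = c)"
proof (induction n)
  case 0
  have "act s \<one> = \<one>" if "s \<in> S" for s
    using that S by (simp add: act_one_right subgroup.mem_carrier)
  then show ?case
    using g the_sylow_closed[OF p] subgroup.one_closed[OF subgroup_the_sylow[OF p]]
    by (intro exI[of _ g] exI[of _ \<one>]) auto
next
  case (Suc n)
  let ?P = "the_sylow G p" and ?V = "commutator_series (Suc n) \<inter> the_sylow G p"
  obtain l c where l: "l \<in> commutator_series n" "l \<in> ?P" and c: "c \<in> ?P" "\<forall>s \<in> S. act s c = c"
    and glc: "g = l \<otimes> c"
    using Suc by blast
  have lc: "l \<in> carrier G" "c \<in> carrier G" using l c p the_sylow_closed by auto
  have SA: "\<And>s. s \<in> S \<Longrightarrow> s \<in> carrier A" using S(1) subgroup.mem_carrier by metis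
  have V: "invariant ?V"
    using invariant_Int commutator_series_invariant invariant_sylow p by blast
  have VG: "?V \<subseteq> carrier G" using subgroup.subset[OF invariant_subgroup[OF V]] .
  let ?E = "?V #> l"
  have EG: "?E \<subseteq> carrier G" using VG lc r_coset_subset_G by blast
  have closed: "act s x \<in> ?E" if s: "s \<in> S" and x: "x \<in> ?E" for s x
  proof -
    have "act s l \<otimes> inv l \<in> ?V"
      using commutator_in_series[OF SA[OF s] l(1)] act_sylow[OF p SA[OF s] l(2)] l(2)
        subgroup_the_sylow[OF p]
      by (auto simp: subgroup.m_closed subgroup.m_inv_closed simp del: commutator_series.simps)
    then have "act s l \<in> ?V #> l"
      using lc SA[OF s] by (simp add: subgroup.rcos_module_rev[OF invariant_subgroup[OF V]] del: commutator_series.simps)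
    then have "?V #> act s l = ?E"
      using repr_independence[OF _ lc(1) invariant_subgroup[OF V]] by blast
    moreover have "act s x \<in> ?V #> act s l"
      using act_image_coset[OF V SA[OF s] lc(1)] x by blast
    ultimately show ?thesis by simp
  qed
  have "\<not> q dvd card ?E"
  proof -
    have "?E \<in> rcosets ?V" using VG lc(1) by (rule rcosetsI)
    then have "card ?E = card ?V"
      using card_rcosets_equal[OF _ VG] by metis
    moreover have "card ?V dvd card ?P"
      using invariant_subgroup[OF V] subgroup_the_sylow[OF p] by (intro card_subgroup_dvd_card) auto
    then have "card ?V dvd p ^ multiplicity p (order G)" using card_the_sylow p by simp
    then have "\<not> q dvd card ?V"
      using p q by (metis dvd_trans prime_dvd_power primes_dvd_imp_eq)
    ultimately show ?thesis by simp
  qed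
  moreover have "[card {x \<in> ?E. \<forall>a \<in> carrier (A\<lparr>carrier := S\<rparr>). act a x = x} = card ?E] (mod q)"
  proof (rule card_fixed_points[OF A.subgroup_imp_group[OF S(1)] _ q(1)])
    show "order (A\<lparr>carrier := S\<rparr>) = q ^ k" using S by (simp add: order_def)
    show "finite ?E" using EG fin finite_subset by blast
  next
    fix a x assume "a \<in> carrier (A\<lparr>carrier := S\<rparr>)" "x \<in> ?E"
    then show "act a x \<in> ?E" using closed[of a x] by simp
  next
    fix x assume "x \<in> ?E"
    then have "x \<in> carrier G" using EG by blast
    then show "act \<one>\<^bsub>A\<lparr>carrier := S\<rparr>\<^esub> x = x" using act_one by simp
  next
    fix a b x assume "a \<in> carrier (A\<lparr>carrier := S\<rparr>)" "b \<in> carrier (A\<lparr>carrier := S\<rparr>)" "x \<in> ?E"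
    moreover from this have "x \<in> carrier G" using EG by blast
    ultimately show "act (a \<otimes>\<^bsub>A\<lparr>carrier := S\<rparr>\<^esub> b) x = act a (act b x)"
      using act_act SA by simp
  qed
  ultimately have "\<not> q dvd card {x \<in> ?E. \<forall>a \<in> carrier (A\<lparr>carrier := S\<rparr>). act a x = x}"
    by (simp only: cong_dvd_iff not_False_eq_True)
  then have "{x \<in> ?E. \<forall>a \<in> S. act a x = x} \<noteq> {}"
    by (intro notI) (simp del: commutator_series.simps)
  then obtain x where x: "x \<in> ?E" "\<forall>s \<in> S. act s x = x" by blast
  then obtain v where v: "v \<in> ?V" "x = v \<otimes> l" unfolding r_coset_def by blast
  have vc: "v \<in> carrier G" using v VG by blast
  have xc: "x \<in> carrier G" using v vc lc by simp
  have "g = inv v \<otimes> (x \<otimes> c)"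
    using vc lc unfolding glc v(2) by (simp add: m_assoc inv_cancel)
  moreover have "inv v \<in> ?V" using subgroup.m_inv_closed[OF invariant_subgroup[OF V] v(1)] .
  moreover have "x \<otimes> c \<in> ?P"
    using v l c subgroup_the_sylow[OF p] by (auto simp: subgroup.m_closed)
  moreover have "\<forall>s \<in> S. act s (x \<otimes> c) = x \<otimes> c"
    using x(2) c(2) SA xc lc by (simp add: act_mult)
  ultimately show ?case by blast
qed

definition residual_kernel :: "nat \<Rightarrow> 'b set" where
  "residual_kernel p = {a \<in> carrier A. \<forall>g \<in> the_sylow G p. act a g \<otimes> inv g \<in> residual}"

lemma sylow_in_residual_kernel:
  assumes p: "prime p" and q: "prime q" "q \<noteq> p" and S: "sylow_subgroup q A S"
  shows "S \<subseteq> residual_kernel p"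
proof
  fix s assume s: "s \<in> S"
  have S': "subgroup S A" "card S = q ^ multiplicity q (order A)"
    using S by (auto simp: sylow_subgroup_def)
  then have sA: "s \<in> carrier A" using s by (meson subgroup.mem_carrier)
  have "act s g \<otimes> inv g \<in> commutator_series (Suc n)" if g: "g \<in> the_sylow G p" for g n
  proof -
    obtain v c where vc: "v \<in> commutator_series n" "v \<in> the_sylow G p" "c \<in> the_sylow G p"
      "g = v \<otimes> c" "act s c = c"
      using fixed_point_decomposition[OF p q S' g, of n] s by blast
    have "v \<in> carrier G" "c \<in> carrier G" using vc p the_sylow_closed by auto
    then have "act s g \<otimes> inv g = act s v \<otimes> inv v"
      using vc(5) sA unfolding vc(4) by (simp add: act_mult inv_mult_group m_assoc inv_cancel)
    then show ?thesis using commutator_in_series[OF sA vc(1)] by simp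
  qed
  then have "act s g \<otimes> inv g \<in> commutator_series n" if "g \<in> the_sylow G p" for g n
    using that commutator_series_Suc_mono by blast
  then show "s \<in> residual_kernel p"
    using sA by (simp add: residual_kernel_def residual_def)
qed

text \<open>Closure under products and inverses is telescoping, since $(a b)(g)\, g^{-1} = a(h) h^{-1} \cdot h g^{-1}$
  for $h = b(g)$; closure under conjugation holds because the residual is invariant.\<close>

lemma residual_kernel_normal:
  assumes p: "prime p"
  shows "residual_kernel p \<lhd> A"
proof -
  let ?P = "the_sylow G p" and ?B = "residual_kernel p"
  note L = subgroup_residual
  have PG: "\<And>g. g \<in> ?P \<Longrightarrow> g \<in> carrier G" using p the_sylow_closed by blast
  have sub: "subgroup ?B A"
  proof (rule A.subgroupI)
    show "?B \<subseteq> carrier A" by (auto simp: residual_kernel_def)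
    have "\<one>\<^bsub>A\<^esub> \<in> ?B"
      using subgroup.one_closed[OF L] PG by (simp add: residual_kernel_def act_one)
    then show "?B \<noteq> {}" by blast
  next
    fix a assume a: "a \<in> ?B"
    then have aA: "a \<in> carrier A" by (simp add: residual_kernel_def)
    have "act (inv\<^bsub>A\<^esub> a) g \<otimes> inv g \<in> residual" if g: "g \<in> ?P" for g
    proof -
      let ?h = "act (inv\<^bsub>A\<^esub> a) g"
      have h: "?h \<in> ?P" using act_sylow[OF p] aA g by simp
      then have "inv (act a ?h \<otimes> inv ?h) \<in> residual"
        using a subgroup.m_inv_closed[OF L] by (simp add: residual_kernel_def)
      then show ?thesis
        using PG[OF g] PG[OF h] aA by (simp add: act_inverse inv_mult_group)
    qed
    then show "inv\<^bsub>A\<^esub> a \<in> ?B" using aA by (simp add: residual_kernel_def)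
  next
    fix a b assume ab: "a \<in> ?B" "b \<in> ?B"
    then have abA: "a \<in> carrier A" "b \<in> carrier A" by (simp_all add: residual_kernel_def)
    have "act (a \<otimes>\<^bsub>A\<^esub> b) g \<otimes> inv g \<in> residual" if g: "g \<in> ?P" for g
    proof -
      let ?h = "act b g"
      have h: "?h \<in> ?P" using act_sylow[OF p] abA g by simp
      then have "(act a ?h \<otimes> inv ?h) \<otimes> (?h \<otimes> inv g) \<in> residual"
        using ab g subgroup.m_closed[OF L] by (simp add: residual_kernel_def)
      then show ?thesis
        using PG[OF g] PG[OF h] abA by (simp add: act_act m_assoc inv_cancel)
    qed
    then show "a \<otimes>\<^bsub>A\<^esub> b \<in> ?B" using abA by (simp add: residual_kernel_def)
  qed
  moreover have "x \<otimes>\<^bsub>A\<^esub> a \<otimes>\<^bsub>A\<^esub> inv\<^bsub>A\<^esub> x \<in> ?B" if x: "x \<in> carrier A" and a: "a \<in> ?B" for x a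
  proof -
    have aA: "a \<in> carrier A" using a by (simp add: residual_kernel_def)
    have "act (x \<otimes>\<^bsub>A\<^esub> a \<otimes>\<^bsub>A\<^esub> inv\<^bsub>A\<^esub> x) g \<otimes> inv g \<in> residual" if g: "g \<in> ?P" for g
    proof -
      let ?h = "act (inv\<^bsub>A\<^esub> x) g"
      have h: "?h \<in> ?P" using act_sylow[OF p] x g by simp
      then have "act x (act a ?h \<otimes> inv ?h) \<in> residual"
        using a x invariant_act[OF residual_invariant] by (simp add: residual_kernel_def)
      then show ?thesis
        using PG[OF g] PG[OF h] x aA by (simp add: act_act act_mult act_inv act_inverse)
    qed
    then show ?thesis using x aA by (simp add: residual_kernel_def)
  qed
  ultimately show ?thesis by (simp add: A.normal_inv_iff)
qed

lemma index_residual_kernel: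
  assumes p: "prime p"
  shows "\<exists>a. card (rcosets\<^bsub>A\<^esub> (residual_kernel p)) = p ^ a"
proof (rule prime_power_if_no_other_prime[OF _ p])
  have B: "subgroup (residual_kernel p) A"
    using residual_kernel_normal[OF p] by (rule normal_imp_subgroup)
  show "0 < card (rcosets\<^bsub>A\<^esub> (residual_kernel p))"
    using A.lagrange[OF B] finA A.order_gt_0_iff_finite by (metis mult_0 neq0_conv less_irrefl)
  fix q :: nat assume q: "prime q" "q \<noteq> p"
  obtain S where "sylow_subgroup q A S" using A.sylow_subgroup_exists finA q by blast
  then show "\<not> q dvd card (rcosets\<^bsub>A\<^esub> (residual_kernel p))"
    using A.index_coprime_if_contains_sylow[OF finA q(1) _ B] sylow_in_residual_kernel p q by blast
qed

subsection \<open>The residual is normal\<close>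

definition residual_part :: "nat \<Rightarrow> 'a set" where
  "residual_part p = residual \<inter> the_sylow G p"

text \<open>This takes the role of the commutator subgroup $[G_p, O^p(A)]$, where $O^p(A)$ is generated by
  the elements of order prime to \<open>p\<close>: all of them lie in \<open>residual_kernel p\<close>.\<close>

definition coprime_commutators :: "nat \<Rightarrow> 'a set" where
  "coprime_commutators p =
     generate G {act a g \<otimes> inv g | a g. a \<in> residual_kernel p \<and> g \<in> the_sylow G p}"

lemma residual_part_invariant: "prime p \<Longrightarrow> invariant (residual_part p)"
  by (simp add: residual_part_def invariant_Int residual_invariant invariant_sylow)

lemma coprime_commutators_invariant:
  assumes p: "prime p"
  shows "invariant (coprime_commutators p)"
  unfolding coprime_commutators_def
  using residual_kernel_normal[OF p] A.normal_inv_iff normal_imp_subgroup[OF residual_kernel_normal[OF p]]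
  by (intro commutators_invariant invariant_sylow p) (auto simp: subgroup.mem_carrier)

lemma coprime_commutators_subset:
  assumes p: "prime p"
  shows "coprime_commutators p \<subseteq> residual_part p"
  unfolding coprime_commutators_def
proof (rule generate_subgroup_incl)
  show "subgroup (residual_part p) G"
    using residual_part_invariant[OF p] by (rule invariant_subgroup)
  show "{act a g \<otimes> inv g | a g. a \<in> residual_kernel p \<and> g \<in> the_sylow G p} \<subseteq> residual_part p"
    using subgroup_the_sylow[OF p] act_sylow[OF p]
    by (auto simp: residual_part_def residual_kernel_def subgroup.m_closed subgroup.m_inv_closed)
qed

text \<open>With $[a, g] = a(g) g^{-1}$ this is the identity $h [a, g] h^{-1} = [a, h]^{-1} [a, h g]$.\<close>

lemma coprime_commutators_normalized:
  assumes p: "prime p" and h: "h \<in> the_sylow G p" and x: "x \<in> coprime_commutators p"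
  shows "h \<otimes> x \<otimes> inv h \<in> coprime_commutators p"
proof -
  let ?S = "{act a g \<otimes> inv g | a g. a \<in> residual_kernel p \<and> g \<in> the_sylow G p}"
  have hG: "h \<in> carrier G" using h p the_sylow_closed by blast
  have BA: "\<And>a. a \<in> residual_kernel p \<Longrightarrow> a \<in> carrier A" by (simp add: residual_kernel_def)
  have PG: "\<And>g. g \<in> the_sylow G p \<Longrightarrow> g \<in> carrier G" using p the_sylow_closed by blast
  have K: "subgroup (coprime_commutators p) G"
    using coprime_commutators_invariant[OF p] by (rule invariant_subgroup)
  have KG: "\<And>y. y \<in> coprime_commutators p \<Longrightarrow> y \<in> carrier G" using K subgroup.mem_carrier by metis
  have gen: "act a g \<otimes> inv g \<in> coprime_commutators p"
    if "a \<in> residual_kernel p" "g \<in> the_sylow G p" for a g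
    using that unfolding coprime_commutators_def by (blast intro: generate.incl)
  have conj: "h \<otimes> (act a g \<otimes> inv g) \<otimes> inv h \<in> coprime_commutators p"
    if a: "a \<in> residual_kernel p" and g: "g \<in> the_sylow G p" for a g
  proof -
    have "h \<otimes> g \<in> the_sylow G p"
      using h g subgroup_the_sylow[OF p] by (simp add: subgroup.m_closed)
    then have "inv (act a h \<otimes> inv h) \<otimes> (act a (h \<otimes> g) \<otimes> inv (h \<otimes> g)) \<in> coprime_commutators p"
      using gen[OF a h] gen[OF a] K by (simp add: subgroup.m_closed subgroup.m_inv_closed)
    then show ?thesis
      using hG PG[OF g] BA[OF a] by (simp add: act_mult inv_mult_group m_assoc inv_cancel)
  qed
  from x show ?thesis
    unfolding coprime_commutators_def[of p]
  proof (induction rule: generate.induct)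
    case one
    then show ?case using hG generate.one[of G] by simp
  next
    case (incl y)
    then show ?case using conj by (auto simp: coprime_commutators_def)
  next
    case (inv y)
    then obtain a g where ag: "a \<in> residual_kernel p" "g \<in> the_sylow G p" "y = act a g \<otimes> inv g"
      by blast
    then have "y \<in> carrier G" using BA PG by simp
    then have "h \<otimes> inv y \<otimes> inv h = inv (h \<otimes> y \<otimes> inv h)"
      using hG by (simp add: inv_mult_group m_assoc)
    then show ?case
      using conj[OF ag(1,2)] ag(3) subgroup.m_inv_closed[OF K] by (simp add: coprime_commutators_def)
  next
    case (eng y z)
    then have yz: "y \<in> carrier G" "z \<in> carrier G"
      using KG by (simp_all add: coprime_commutators_def)
    have "h \<otimes> (y \<otimes> z) \<otimes> inv h = (h \<otimes> y \<otimes> inv h) \<otimes> (h \<otimes> z \<otimes> inv h)"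
      using hG yz by (simp add: m_assoc inv_cancel)
    then show ?case using eng by (simp add: generate.eng)
  qed
qed

lemma normalizer_act:
  assumes T: "invariant T" and x: "x \<in> normalizer G T" and a: "a \<in> carrier A"
  shows "act a x \<in> normalizer G T"
proof -
  have sub: "subgroup T G" using T by (rule invariant_subgroup)
  have xG: "x \<in> carrier G" and
    n: "\<And>h. h \<in> T \<Longrightarrow> x \<otimes> h \<otimes> inv x \<in> T" "\<And>h. h \<in> T \<Longrightarrow> inv x \<otimes> h \<otimes> x \<in> T"
    using x mem_normalizer_iff[OF sub] by auto
  have "act a x \<otimes> h \<otimes> inv (act a x) \<in> T \<and> inv (act a x) \<otimes> h \<otimes> act a x \<in> T" if h: "h \<in> T" for h
  proof -
    obtain k where k: "k \<in> T" "h = act a k"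
      using act_image_invariant[OF T a] h by blast
    then have "k \<in> carrier G" using sub subgroup.mem_carrier by metis
    then have "act a (x \<otimes> k \<otimes> inv x) = act a x \<otimes> h \<otimes> inv (act a x)"
      "act a (inv x \<otimes> k \<otimes> x) = inv (act a x) \<otimes> h \<otimes> act a x"
      using a xG k(2) by (simp_all add: act_mult act_inv)
    then show ?thesis
      using n[OF k(1)] invariant_act[OF T a] by metis
  qed
  then show ?thesis
    using a xG by (simp add: mem_normalizer_iff[OF sub])
qed

text \<open>The stabilizer of the coset of \<open>l\<close> contains a Sylow subgroup of \<open>A\<close> for every prime, so its index
  is \<open>1\<close>: for primes other than \<open>p\<close> because of \<open>coprime_commutators p\<close>, and for \<open>p\<close> it
  contains \<open>S\<close>.\<close>

lemma coset_fixed_by_all: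
  assumes p: "prime p" and T: "invariant T" "coprime_commutators p \<subseteq> T"
    and S: "sylow_subgroup p A S" and l: "l \<in> the_sylow G p"
    and fixed: "\<And>s. s \<in> S \<Longrightarrow> act s l \<otimes> inv l \<in> T" and a: "a \<in> carrier A"
  shows "act a l \<otimes> inv l \<in> T"
proof -
  let ?C = "{a \<in> carrier A. act a l \<otimes> inv l \<in> T}"
  have sub: "subgroup T G" using T by (simp add: invariant_subgroup)
  have lG: "l \<in> carrier G" using l p the_sylow_closed by blast
  have C: "subgroup ?C A"
  proof (rule A.subgroupI)
    have "\<one>\<^bsub>A\<^esub> \<in> ?C" using lG sub by (simp add: act_one subgroup.one_closed)
    then show "?C \<noteq> {}" by blast
  next
    fix a assume a: "a \<in> ?C"
    then have "inv (act (inv\<^bsub>A\<^esub> a) (act a l \<otimes> inv l)) \<in> T"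
      using invariant_act[OF T(1)] subgroup.m_inv_closed[OF sub] by simp
    then show "inv\<^bsub>A\<^esub> a \<in> ?C"
      using a lG by (simp add: act_mult act_inv act_inverse inv_mult_group)
  next
    fix a b assume ab: "a \<in> ?C" "b \<in> ?C"
    then have "act a (act b l \<otimes> inv l) \<otimes> (act a l \<otimes> inv l) \<in> T"
      using invariant_act[OF T(1)] subgroup.m_closed[OF sub] by simp
    then show "a \<otimes>\<^bsub>A\<^esub> b \<in> ?C"
      using ab lG by (simp add: act_mult act_inv act_act m_assoc inv_cancel)
  qed auto
  have BC: "residual_kernel p \<subseteq> ?C"
  proof
    fix a assume a: "a \<in> residual_kernel p"
    then have "act a l \<otimes> inv l \<in> coprime_commutators p"
      using l unfolding coprime_commutators_def by (blast intro: generate.incl)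
    then show "a \<in> ?C" using a T(2) by (auto simp: residual_kernel_def)
  qed
  have "card (rcosets\<^bsub>A\<^esub> ?C) = 1"
  proof (rule ccontr)
    assume "card (rcosets\<^bsub>A\<^esub> ?C) \<noteq> 1"
    then obtain q where q: "prime q" "q dvd card (rcosets\<^bsub>A\<^esub> ?C)"
      using prime_factor_nat by blast
    obtain R where R: "sylow_subgroup q A R" "R \<subseteq> ?C"
    proof (cases "q = p")
      case True
      have "S \<subseteq> ?C" using fixed S by (auto simp: sylow_subgroup_def subgroup.mem_carrier)
      then show ?thesis using that True S by blast
    next
      case False
      obtain R where "sylow_subgroup q A R" using A.sylow_subgroup_exists finA q by blast
      then show ?thesis
        using that sylow_in_residual_kernel[OF p q(1) False] BC by blast
    qed
    then show False
      using A.index_coprime_if_contains_sylow[OF finA q(1) R(1) C R(2)] q(2) by simp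
  qed
  then have "card ?C = order A" using A.lagrange[OF C] by simp
  then have "?C = carrier A"
    using finA by (intro card_subset_eq) (auto simp: order_def)
  then show ?thesis using a by blast
qed

text \<open>A Sylow \<open>p\<close>-subgroup of \<open>A\<close> permutes the cosets of \<open>T\<close> in its normalizer within the \<open>p\<close>-group.
  Their number is divisible by \<open>p\<close>, so besides \<open>T\<close> itself there is another fixed coset.\<close>

lemma fixed_coset_exists:
  assumes p: "prime p" and T: "invariant T" "coprime_commutators p \<subseteq> T"
    and R: "invariant R" "R \<subseteq> the_sylow G p" and proper: "T \<subset> R"
  obtains l where "l \<in> R" "l \<in> normalizer G T" "l \<notin> T"
    "\<And>a. a \<in> carrier A \<Longrightarrow> act a l \<otimes> inv l \<in> T"
proof -
  note sub = invariant_subgroup[OF T(1)]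
  have subR: "subgroup R G" using R by (simp add: invariant_subgroup)
  define N where "N = normalizer G T \<inter> R"
  have subN: "subgroup N G"
    using subgroups_Inter_pair subgroup_normalizer[OF sub] subR by (simp add: N_def)
  have N: "invariant N"
    using subN normalizer_act[OF T(1)] invariant_act[OF R(1)] by (intro invariantI) (auto simp: N_def)
  have NG: "\<And>x. x \<in> N \<Longrightarrow> x \<in> carrier G" using subN subgroup.mem_carrier by metis
  have TN: "T \<subseteq> N"
    using proper subgroup.subset[OF normal_imp_subgroup[OF normal_in_normalizer[OF sub]]]
    by (auto simp: N_def)
  obtain x where x: "x \<in> R" "x \<in> normalizer G T" "x \<notin> T"
    using normalizer_grows[OF sub subR proper] by blast
  let ?N = "G\<lparr>carrier := N\<rparr>"
  interpret N: group ?N using subN by (rule subgroup_imp_group)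
  have subTN: "subgroup T ?N" using sub subN TN by (rule subgroup_incl)
  define E where "E = rcosets\<^bsub>?N\<^esub> T"
  have E: "E = (\<lambda>y. T #> y) ` N" by (auto simp: E_def RCOSETS_def)
  have finN: "finite N" using finite_subset[OF subgroup.subset[OF subN] fin] .
  then have finE: "finite E" by (simp add: E)
  have TE: "T \<in> E" using subgroup.subgroup_in_rcosets[OF subTN N.is_group] by (simp add: E_def)
  have lagr: "card E * card T = card N"
    using N.lagrange[OF subTN] by (simp add: E_def order_def)
  have "card E \<noteq> 1"
  proof
    assume "card E = 1"
    then have "card T = card N" using lagr by simp
    then have "T = N" using finN TN by (intro card_subset_eq)
    then show False using x unfolding N_def by blast
  qed
  moreover have "card N dvd p ^ multiplicity p (order G)"
    using card_subgroup_dvd_card[OF subN subgroup_the_sylow[OF p]] R(2) card_the_sylow[OF p]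
    by (auto simp: N_def)
  then have "card E dvd p ^ multiplicity p (order G)" using lagr by (metis dvd_mult_left)
  then obtain b where "card E = p ^ b" using p divides_primepow_nat by blast
  ultimately have pE: "p dvd card E" by (cases b) auto
  obtain S where S: "sylow_subgroup p A S" using A.sylow_subgroup_exists finA p by blast
  have subS: "subgroup S A" and cardS: "card S = p ^ multiplicity p (order A)"
    using S by (auto simp: sylow_subgroup_def)
  have SA: "\<And>s. s \<in> S \<Longrightarrow> s \<in> carrier A" using subS subgroup.mem_carrier by metis
  have img: "act a ` (T #> y) = T #> act a y" if "a \<in> carrier A" "y \<in> N" for a y
    using act_image_coset[OF T(1)] that NG by blast
  let ?Fix = "{C \<in> E. \<forall>a \<in> carrier (A\<lparr>carrier := S\<rparr>). act a ` C = C}"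
  have "[card ?Fix = card E] (mod p)"
  proof (rule card_fixed_points[OF A.subgroup_imp_group[OF subS] _ p finE])
    show "order (A\<lparr>carrier := S\<rparr>) = p ^ multiplicity p (order A)" using cardS by (simp add: order_def)
  next
    fix a C assume "a \<in> carrier (A\<lparr>carrier := S\<rparr>)" "C \<in> E"
    then show "act a ` C \<in> E"
      using img[OF SA] invariant_act[OF N SA] by (auto simp: E)
  next
    fix C assume "C \<in> E"
    then show "act \<one>\<^bsub>A\<lparr>carrier := S\<rparr>\<^esub> ` C = C"
      using img[OF A.one_closed] NG by (auto simp: E act_one)
  next
    fix a b C assume ab: "a \<in> carrier (A\<lparr>carrier := S\<rparr>)" "b \<in> carrier (A\<lparr>carrier := S\<rparr>)" "C \<in> E"
    then obtain y where y: "y \<in> N" "C = T #> y" by (auto simp: E)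
    have abA: "a \<in> carrier A" "b \<in> carrier A" using ab SA by simp_all
    then show "act (a \<otimes>\<^bsub>A\<lparr>carrier := S\<rparr>\<^esub> b) ` C = act a ` act b ` C"
      using y NG[OF y(1)] invariant_act[OF N abA(2) y(1)] by (simp add: img act_act)
  qed
  then have dvd: "p dvd card ?Fix" using pE by (simp add: cong_dvd_iff)
  have TFix: "T \<in> ?Fix"
    using TE act_image_invariant[OF T(1)] SA by simp
  have "\<not> ?Fix \<subseteq> {T}"
  proof
    assume "?Fix \<subseteq> {T}"
    then have "?Fix = {T}" using TFix by blast
    then have "card ?Fix = card {T}" by (rule arg_cong)
    then have "p dvd 1" using dvd by (simp only: card_1_singleton_iff) simp
    then show False using p not_prime_unit by blast
  qed
  then obtain C where C: "C \<in> E" "\<forall>s \<in> S. act s ` C = C" "C \<noteq> T" by auto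
  then obtain l where l: "l \<in> N" "C = T #> l" by (auto simp: E)
  have lG: "l \<in> carrier G" using l NG by blast
  have "l \<notin> T" using C(3) l(2) coset_join2[OF lG sub] by blast
  moreover have "act s l \<otimes> inv l \<in> T" if s: "s \<in> S" for s
  proof -
    have "T #> act s l = T #> l"
      using C(2) s l img[OF SA[OF s] l(1)] by simp
    then have "act s l \<in> T #> l"
      using rcos_self[OF _ sub] SA[OF s] lG by (metis act_closed)
    then show ?thesis
      using subgroup.rcos_module_imp[OF sub is_group lG] by blast
  qed
  then have "act a l \<otimes> inv l \<in> T" if "a \<in> carrier A" for a
    using coset_fixed_by_all[OF p T S _ _ that] l R(2) by (auto simp: N_def)
  ultimately show thesis using that l(1) unfolding N_def by blast
qed

text \<open>Taking \<open>p\<close>-parts maps the generators of the residual to commutators of its \<open>p\<close>-part.\<close>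

lemma residual_part_commutators:
  assumes p: "prime p" and T: "subgroup T G"
    and comm: "\<And>a x. \<lbrakk>a \<in> carrier A; x \<in> residual_part p\<rbrakk> \<Longrightarrow> act a x \<otimes> inv x \<in> T"
  shows "residual_part p \<subseteq> T"
proof
  have LG: "\<And>x. x \<in> residual \<Longrightarrow> x \<in> carrier G" using subgroup_residual subgroup.mem_carrier by metis
  have comm': "primary p (act a x \<otimes> inv x) \<in> T" if "a \<in> carrier A" "x \<in> residual" for a x
  proof -
    have "primary p x \<in> residual_part p"
      using that primary_in_sylow[OF p LG] primary_mem_subgroup[OF subgroup_residual]
      by (simp add: residual_part_def)
    then show ?thesis
      using comm[OF that(1)] that LG[OF that(2)] p
      by (simp add: primary_mult primary_inv flip: act_primary)
  qed
  have all: "primary p y \<in> T"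
    if "y \<in> generate G {act a x \<otimes> inv x | a x. a \<in> carrier A \<and> x \<in> residual}" for y
    using that
  proof (induction rule: generate.induct)
    case one
    then show ?case using T by (simp add: primary_def subgroup.one_closed)
  next
    case (incl h)
    then show ?case using comm' by blast
  next
    case (inv h)
    then obtain a x where "a \<in> carrier A" "x \<in> residual" "h = act a x \<otimes> inv x" by blast
    then show ?case
      using comm' LG p T by (simp add: primary_inv subgroup.m_inv_closed)
  next
    case (eng h k)
    then have "h \<in> carrier G" "k \<in> carrier G"
      using LG unfolding residual_generated[symmetric] by auto
    then show ?case using eng p T by (simp add: primary_mult subgroup.m_closed)
  qed
  fix y assume y: "y \<in> residual_part p"
  then have "primary p y \<in> T"
    using all residual_generated by (simp add: residual_part_def)
  then show "y \<in> T" using y primary_sylow[OF p] by (simp add: residual_part_def)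
qed

text \<open>Suppose that the commutators generate a proper subgroup, and let \<open>T\<close> be a maximal proper
  invariant subgroup of the \<open>p\<close>-part of the residual that contains them. The elements that normalize \<open>T\<close> and are fixed modulo \<open>T\<close>
  form a larger invariant subgroup, so \<open>A\<close> acts trivially modulo \<open>T\<close>, whereas the residual is
  generated by its commutators with \<open>A\<close>.\<close>

lemma residual_part_eq_coprime_commutators:
  assumes p: "prime p"
  shows "residual_part p = coprime_commutators p"
proof (rule ccontr)
  let ?R = "residual_part p"
  assume ne: "?R \<noteq> coprime_commutators p"
  have R: "invariant ?R" using residual_part_invariant p by blast
  note subR = invariant_subgroup[OF R]
  define \<T> where "\<T> = {T. invariant T \<and> coprime_commutators p \<subseteq> T \<and> T \<subset> ?R}"
  have "finite \<T>"
    using fin subgroup.subset[OF subR] by (intro finite_subset[of \<T> "Pow (carrier G)"]) (auto simp: \<T>_def)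
  moreover have "coprime_commutators p \<in> \<T>"
    using ne coprime_commutators_subset[OF p] coprime_commutators_invariant[OF p] by (auto simp: \<T>_def)
  ultimately obtain T where T: "T \<in> \<T>" and max: "\<And>K. \<lbrakk>K \<in> \<T>; T \<subseteq> K\<rbrakk> \<Longrightarrow> T = K"
    using finite_has_maximal[of \<T>] by blast
  have inv: "invariant T" "coprime_commutators p \<subseteq> T" "T \<subset> ?R" using T by (auto simp: \<T>_def)
  note sub = invariant_subgroup[OF inv(1)]
  obtain l where l: "l \<in> ?R" "l \<in> normalizer G T" "l \<notin> T"
    "\<And>a. a \<in> carrier A \<Longrightarrow> act a l \<otimes> inv l \<in> T"
    using fixed_coset_exists[OF p inv(1,2) R _ inv(3)] by (auto simp: residual_part_def)
  define U where "U = {x \<in> ?R. x \<in> normalizer G T \<and> (\<forall>a \<in> carrier A. act a x \<otimes> inv x \<in> T)}"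
  have RG: "\<And>x. x \<in> ?R \<Longrightarrow> x \<in> carrier G" using subR subgroup.mem_carrier by metis
  have subN: "subgroup (normalizer G T) G" using sub by (rule subgroup_normalizer)
  have TN: "T \<subseteq> normalizer G T"
    using subgroup.subset[OF normal_imp_subgroup[OF normal_in_normalizer[OF sub]]] by simp
  have TG: "\<And>x. x \<in> T \<Longrightarrow> x \<in> carrier G" using sub subgroup.mem_carrier by metis
  have norm: "x \<otimes> t \<otimes> inv x \<in> T" "inv x \<otimes> t \<otimes> x \<in> T" if "x \<in> normalizer G T" "t \<in> T" for x t
    using that mem_normalizer_iff[OF sub] by auto
  have "subgroup U G"
  proof (rule subgroupI)
    show "U \<subseteq> carrier G" using RG by (auto simp: U_def)
    show "U \<noteq> {}" using l by (auto simp: U_def)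
  next
    fix x assume x: "x \<in> U"
    then have c: "x \<in> carrier G" using RG by (simp add: U_def)
    have "act a (inv x) \<otimes> inv (inv x) \<in> T" if a: "a \<in> carrier A" for a
    proof -
      have "inv x \<otimes> inv (act a x \<otimes> inv x) \<otimes> x \<in> T"
        using x a norm(2) subgroup.m_inv_closed[OF sub] by (simp add: U_def)
      moreover have "inv x \<otimes> inv (act a x \<otimes> inv x) \<otimes> x = act a (inv x) \<otimes> inv (inv x)"
        using a c by (simp add: act_inv inv_mult_group m_assoc inv_cancel)
      ultimately show ?thesis by simp
    qed
    then show "inv x \<in> U"
      using x subgroup.m_inv_closed[OF subR] subgroup.m_inv_closed[OF subN] by (simp add: U_def)
  next
    fix x y assume x: "x \<in> U" and y: "y \<in> U"
    then have c: "x \<in> carrier G" "y \<in> carrier G" using RG by (simp_all add: U_def)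
    have "act a (x \<otimes> y) \<otimes> inv (x \<otimes> y) \<in> T" if a: "a \<in> carrier A" for a
    proof -
      have "(act a x \<otimes> inv x) \<otimes> (x \<otimes> (act a y \<otimes> inv y) \<otimes> inv x) \<in> T"
        using x y a norm(1) subgroup.m_closed[OF sub] by (simp add: U_def)
      then show ?thesis
        using a c by (simp add: act_mult inv_mult_group m_assoc inv_cancel)
    qed
    then show "x \<otimes> y \<in> U"
      using x y subgroup.m_closed[OF subR] subgroup.m_closed[OF subN] by (simp add: U_def)
  qed
  then have "invariant U"
  proof (rule invariantI)
    fix b x assume b: "b \<in> carrier A" and x: "x \<in> U"
    then have c: "x \<in> carrier G" using RG by (simp add: U_def)
    have "act a (act b x) \<otimes> inv (act b x) \<in> T" if a: "a \<in> carrier A" for a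
    proof -
      have "(act (a \<otimes>\<^bsub>A\<^esub> b) x \<otimes> inv x) \<otimes> inv (act b x \<otimes> inv x) \<in> T"
        using x a b subgroup.m_closed[OF sub] subgroup.m_inv_closed[OF sub] by (simp add: U_def)
      then show ?thesis
        using a b c by (simp add: act_act inv_mult_group m_assoc inv_cancel)
    qed
    then show "act b x \<in> U"
      using x b invariant_act[OF R b] normalizer_act[OF inv(1) _ b] by (simp add: U_def)
  qed
  moreover have "T \<subseteq> U"
    using inv(3) TN TG invariant_act[OF inv(1)] sub
    by (auto simp: U_def subgroup.m_closed subgroup.m_inv_closed)
  moreover have "U \<noteq> T" using l by (auto simp: U_def)
  ultimately have "\<not> U \<subset> ?R"
    using max[of U] inv(2) by (auto simp: \<T>_def)
  then have "U = ?R" by (auto simp: U_def)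
  then have "?R \<subseteq> T"
    using residual_part_commutators[OF p sub] by (auto simp: U_def)
  then show False using inv(3) by blast
qed

text \<open>Taking \<open>p\<close>-parts commutes with conjugation, so it suffices to conjugate the \<open>p\<close>-part of an
  element of the residual by an element of the Sylow \<open>p\<close>-subgroup.\<close>

theorem residual_normal: "residual \<lhd> G"
  unfolding normal_inv_iff
proof (intro conjI ballI)
  show "subgroup residual G" by (rule subgroup_residual)
  fix x l assume x: "x \<in> carrier G" and l: "l \<in> residual"
  have lG: "l \<in> carrier G" using l subgroup_residual subgroup.mem_carrier by metis
  show "x \<otimes> l \<otimes> inv x \<in> residual"
  proof (rule mem_subgroup_if_primary[OF subgroup_residual])
    show "x \<otimes> l \<otimes> inv x \<in> carrier G" using x lG by simp
    fix p :: nat assume p: "prime p"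
    have "primary p l \<in> coprime_commutators p"
      using p l lG primary_in_sylow primary_mem_subgroup[OF subgroup_residual]
      by (simp add: residual_part_eq_coprime_commutators[symmetric] residual_part_def)
    then have "primary p x \<otimes> primary p l \<otimes> inv (primary p x) \<in> residual_part p"
      using coprime_commutators_normalized p x primary_in_sylow
      by (simp add: residual_part_eq_coprime_commutators)
    then show "primary p (x \<otimes> l \<otimes> inv x) \<in> residual"
      using p x lG by (simp add: primary_mult primary_inv residual_part_def)
  qed
qed

end

section \<open>The quotient by the residual and the automorphisms induced on it\<close>

context nilpotent_group_action
begin

text \<open>The constructions that lead from a skew brace to $Q$, $\Delta$, their primary components and the
  natural maps between them only use the action, and are repeated here for an arbitrary one.\<close>

definition quotient :: "'a set monoid" where
  "quotient = G Mod residual"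

definition induced :: "'b \<Rightarrow> 'a set \<Rightarrow> 'a set" where
  "induced a = (\<lambda>C \<in> carrier quotient. act a ` C)"

definition induced_group :: "('a set \<Rightarrow> 'a set) monoid" where
  "induced_group = AutoGroup quotient \<lparr>carrier := induced ` carrier A\<rparr>"

definition component :: "nat \<Rightarrow> 'a set monoid" where
  "component p = (G\<lparr>carrier := the_sylow G p\<rparr>) Mod residual_part p"

definition embed :: "'a set \<Rightarrow> 'a set" where
  "embed D = residual <#> D"

definition proj :: "nat \<Rightarrow> 'a set \<Rightarrow> 'a set" where
  "proj p C = {g \<in> the_sylow G p. \<exists>h \<in> sylow_complement p. g \<otimes> h \<in> C}"

definition component_centralizer :: "nat \<Rightarrow> ('a set \<Rightarrow> 'a set) set" where
  "component_centralizer p =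
     {\<delta> \<in> carrier induced_group. \<forall>D \<in> carrier (component p). \<delta> (embed D) = embed D}"

definition restr :: "nat \<Rightarrow> ('a set \<Rightarrow> 'a set) \<Rightarrow> 'a set \<Rightarrow> 'a set" where
  "restr p \<delta> = (\<lambda>D \<in> carrier (component p). proj p (\<delta> (embed D)))"

definition component_action :: "nat \<Rightarrow> ('a set \<Rightarrow> 'a set) set \<Rightarrow> 'a set \<Rightarrow> 'a set" where
  "component_action p K = the_elem (restr p ` K)"

lemma residual_closed: "x \<in> residual \<Longrightarrow> x \<in> carrier G"
  using subgroup_residual subgroup.mem_carrier by metis

lemma residual_subset: "residual \<subseteq> carrier G"
  using residual_closed by blast

lemma group_quotient: "group quotient"
  unfolding quotient_def using residual_normal by (rule normal.factorgroup_is_group)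

lemma carrier_quotient: "carrier quotient = (\<lambda>x. residual #> x) ` carrier G"
  by (simp add: quotient_def carrier_FactGroup)

lemma mult_quotient:
  "\<lbrakk>x \<in> carrier G; y \<in> carrier G\<rbrakk> \<Longrightarrow>
    (residual #> x) \<otimes>\<^bsub>quotient\<^esub> (residual #> y) = residual #> (x \<otimes> y)"
  by (simp add: quotient_def normal.rcos_sum[OF residual_normal])

lemma coset_eq_iff:
  assumes H: "subgroup H G" and "x \<in> carrier G" "y \<in> carrier G"
  shows "H #> x = H #> y \<longleftrightarrow> x \<otimes> inv y \<in> H"
proof
  assume "H #> x = H #> y"
  then have "x \<in> H #> y" using assms rcos_self by blast
  then show "x \<otimes> inv y \<in> H" using assms subgroup.rcos_module[OF H is_group] by blast
next
  assume "x \<otimes> inv y \<in> H"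
  then have "x \<in> H #> y" using assms subgroup.rcos_module[OF H is_group] by blast
  then show "H #> x = H #> y" using assms repr_independence by blast
qed

lemma induced_coset:
  "\<lbrakk>a \<in> carrier A; x \<in> carrier G\<rbrakk> \<Longrightarrow> induced a (residual #> x) = residual #> act a x"
  by (auto simp: induced_def carrier_quotient act_image_coset[OF residual_invariant])

lemma induced_eqI:
  assumes "a \<in> carrier A" "b \<in> carrier A"
    and "\<And>x. x \<in> carrier G \<Longrightarrow> residual #> act a x = residual #> act b x"
  shows "induced a = induced b"
proof
  fix C
  show "induced a C = induced b C"
  proof (cases "C \<in> carrier quotient")
    case True
    then obtain x where "x \<in> carrier G" "C = residual #> x" by (auto simp: carrier_quotient)
    then show ?thesis using assms by (simp add: induced_coset)
  qed (simp add: induced_def)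
qed

lemma induced_closed: "\<lbrakk>a \<in> carrier A; C \<in> carrier quotient\<rbrakk> \<Longrightarrow> induced a C \<in> carrier quotient"
  by (auto simp: carrier_quotient induced_coset)

lemma induced_induced:
  "\<lbrakk>a \<in> carrier A; b \<in> carrier A; C \<in> carrier quotient\<rbrakk> \<Longrightarrow>
    induced (a \<otimes>\<^bsub>A\<^esub> b) C = induced a (induced b C)"
  by (auto simp: carrier_quotient induced_coset act_act)

lemma induced_one: "C \<in> carrier quotient \<Longrightarrow> induced \<one>\<^bsub>A\<^esub> C = C"
  by (auto simp: carrier_quotient induced_coset act_one)

lemma induced_Bij:
  assumes a: "a \<in> carrier A"
  shows "induced a \<in> Bij (carrier quotient)"
proof -
  have "bij_betw (induced a) (carrier quotient) (carrier quotient)"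
    by (rule bij_betwI[of _ _ _ "induced (inv\<^bsub>A\<^esub> a)"])
      (use a in \<open>auto simp: induced_closed induced_one simp flip: induced_induced\<close>)
  then show ?thesis by (simp add: Bij_def induced_def)
qed

lemma induced_auto:
  assumes a: "a \<in> carrier A"
  shows "induced a \<in> auto quotient"
proof -
  have "induced a \<in> hom quotient quotient"
  proof (rule homI)
    fix C D assume "C \<in> carrier quotient" "D \<in> carrier quotient"
    then obtain x y where "x \<in> carrier G" "C = residual #> x" "y \<in> carrier G" "D = residual #> y"
      by (auto simp: carrier_quotient)
    then show "induced a (C \<otimes>\<^bsub>quotient\<^esub> D) = induced a C \<otimes>\<^bsub>quotient\<^esub> induced a D"
      using a by (simp add: mult_quotient induced_coset act_mult)
  qed (simp add: a induced_closed)
  then show ?thesis using induced_Bij a by (simp add: auto_def)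
qed

lemma AutoGroup_mult:
  "\<lbrakk>f \<in> auto K; g \<in> auto K\<rbrakk> \<Longrightarrow> f \<otimes>\<^bsub>AutoGroup K\<^esub> g = compose (carrier K) f g"
  by (simp add: AutoGroup_def BijGroup_def auto_def)

lemma induced_mult:
  assumes a: "a \<in> carrier A" and b: "b \<in> carrier A"
  shows "induced (a \<otimes>\<^bsub>A\<^esub> b) = induced a \<otimes>\<^bsub>AutoGroup quotient\<^esub> induced b"
proof
  fix C
  show "induced (a \<otimes>\<^bsub>A\<^esub> b) C = (induced a \<otimes>\<^bsub>AutoGroup quotient\<^esub> induced b) C"
    using a b by (cases "C \<in> carrier quotient")
      (simp_all add: AutoGroup_mult induced_auto compose_def induced_induced, simp add: induced_def)
qed

lemma induced_hom_AutoGroup: "group_hom A (AutoGroup quotient) induced"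
  unfolding group_hom_def group_hom_axioms_def
proof (intro conjI homI)
  show "group A" by (rule A.is_group)
  show "group (AutoGroup quotient)" by (rule group.AutoGroup[OF group_quotient])
  show "induced a \<in> carrier (AutoGroup quotient)" if "a \<in> carrier A" for a
    using that induced_auto by (simp add: AutoGroup_def)
qed (rule induced_mult)

lemma carrier_induced_group: "carrier induced_group = induced ` carrier A"
  by (simp add: induced_group_def)

lemma group_induced_group: "group induced_group"
  unfolding induced_group_def
  using group.subgroup_imp_group[OF group.AutoGroup[OF group_quotient]
      group_hom.img_is_subgroup[OF induced_hom_AutoGroup]] .

lemma induced_group_hom: "group_hom A induced_group induced"
  unfolding group_hom_def group_hom_axioms_def
  by (intro conjI homI A.is_group group_induced_group)
    (auto simp: carrier_induced_group, auto simp: induced_group_def induced_mult)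

lemma induced_group_mult:
  "\<lbrakk>a \<in> carrier A; b \<in> carrier A\<rbrakk> \<Longrightarrow>
    induced a \<otimes>\<^bsub>induced_group\<^esub> induced b = induced (a \<otimes>\<^bsub>A\<^esub> b)"
  by (simp add: induced_group_def induced_mult)

lemma finite_induced_group: "finite (carrier induced_group)"
  by (simp add: carrier_induced_group finA)

subsection \<open>Primary components of the quotient\<close>

lemma residual_part_normal: "prime p \<Longrightarrow> residual_part p \<lhd> G"
  by (simp add: residual_part_def normal_subgroup_intersect residual_normal the_sylow_normal)

lemma subgroup_residual_part: "prime p \<Longrightarrow> subgroup (residual_part p) G"
  using residual_part_normal by (rule normal_imp_subgroup)

lemma residual_part_normal_sylow:
  assumes p: "prime p"
  shows "residual_part p \<lhd> G\<lparr>carrier := the_sylow G p\<rparr>"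
  by (rule normal_restrict_supergroup[OF subgroup_the_sylow[OF p] residual_part_normal[OF p]])
    (simp add: residual_part_def)

lemma group_component: "prime p \<Longrightarrow> group (component p)"
  unfolding component_def using residual_part_normal_sylow by (rule normal.factorgroup_is_group)

lemma carrier_component: "carrier (component p) = (\<lambda>g. residual_part p #> g) ` the_sylow G p"
  by (simp add: component_def carrier_FactGroup)

lemma mult_component:
  assumes "prime p" "x \<in> the_sylow G p" "y \<in> the_sylow G p"
  shows "(residual_part p #> x) \<otimes>\<^bsub>component p\<^esub> (residual_part p #> y) = residual_part p #> (x \<otimes> y)"
  using assms normal.rcos_sum[OF residual_part_normal] the_sylow_closed
  by (simp add: component_def)

lemma one_component: "\<one>\<^bsub>component p\<^esub> = residual_part p"
  by (simp add: component_def)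

lemma embed_coset:
  assumes p: "prime p" and g: "g \<in> carrier G"
  shows "embed (residual_part p #> g) = residual #> g"
proof -
  have sub: "residual_part p \<subseteq> carrier G" using subgroup.subset[OF subgroup_residual_part[OF p]] .
  have "residual <#> residual_part p = residual"
  proof
    show "residual <#> residual_part p \<subseteq> residual"
      using subgroup.m_closed[OF subgroup_residual] by (auto simp: set_mult_def residual_part_def)
    show "residual \<subseteq> residual <#> residual_part p"
    proof
      fix x assume "x \<in> residual"
      then show "x \<in> residual <#> residual_part p"
        using subgroup.one_closed[OF subgroup_residual_part[OF p]] residual_closed
        unfolding set_mult_def by (intro UN_I[of x] UN_I[of \<one>]) auto
    qed
  qed
  then show ?thesis
    using setmult_rcos_assoc[OF residual_subset sub g] by (simp add: embed_def)
qed

text \<open>If \<open>g\<close> lies in the Sylow subgroup and \<open>h\<close> in its complement, then \<open>g\<close> is the \<open>p\<close>-part of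
  \<open>g \<otimes> h\<close>.\<close>

lemma proj_coset:
  assumes p: "prime p" and x: "x \<in> carrier G"
  shows "proj p (residual #> x) = residual_part p #> primary p x"
proof
  show "proj p (residual #> x) \<subseteq> residual_part p #> primary p x"
  proof
    fix g assume "g \<in> proj p (residual #> x)"
    then obtain h r where g: "g \<in> the_sylow G p" and h: "h \<in> sylow_complement p"
      and r: "r \<in> residual" "g \<otimes> h = r \<otimes> x"
      by (auto simp: proj_def r_coset_def)
    have c: "g \<in> carrier G" "h \<in> carrier G" "r \<in> carrier G"
      using g h r p the_sylow_closed sylow_complement_closed residual_closed by auto
    have "g = primary p (g \<otimes> h)"
      using g h c p by (simp add: primary_mult primary_sylow primary_complement)
    also have "\<dots> = primary p r \<otimes> primary p x"
      unfolding r(2) using c x p by (simp add: primary_mult)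
    finally show "g \<in> residual_part p #> primary p x"
      using r(1) c p primary_in_sylow primary_mem_subgroup[OF subgroup_residual]
      by (auto simp: r_coset_def residual_part_def)
  qed
  show "residual_part p #> primary p x \<subseteq> proj p (residual #> x)"
  proof
    fix g assume "g \<in> residual_part p #> primary p x"
    then obtain r where r: "r \<in> residual_part p" "g = r \<otimes> primary p x"
      by (auto simp: r_coset_def)
    let ?h = "inv (primary p x) \<otimes> x"
    have "r \<in> carrier G" using r residual_closed by (simp add: residual_part_def)
    then have "g \<otimes> ?h = r \<otimes> x" using r(2) x by (simp add: m_assoc inv_cancel)
    moreover have "g \<in> the_sylow G p"
      using r primary_in_sylow[OF p x] subgroup.m_closed[OF subgroup_the_sylow[OF p]]
      by (simp add: residual_part_def)
    moreover have "r \<otimes> x \<in> residual #> x"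
      using r(1) by (auto simp: r_coset_def residual_part_def)
    ultimately show "g \<in> proj p (residual #> x)"
      using complement_part[OF p x] unfolding proj_def
      by (intro CollectI conjI bexI[of _ ?h]) simp_all
  qed
qed

lemma proj_closed: "\<lbrakk>prime p; C \<in> carrier quotient\<rbrakk> \<Longrightarrow> proj p C \<in> carrier (component p)"
  by (auto simp: carrier_quotient carrier_component proj_coset primary_in_sylow)

lemma proj_hom:
  assumes p: "prime p"
  shows "proj p \<in> hom quotient (component p)"
proof (rule homI)
  fix C D assume "C \<in> carrier quotient" "D \<in> carrier quotient"
  then obtain x y where "x \<in> carrier G" "C = residual #> x" "y \<in> carrier G" "D = residual #> y"
    by (auto simp: carrier_quotient)
  then show "proj p (C \<otimes>\<^bsub>quotient\<^esub> D) = proj p C \<otimes>\<^bsub>component p\<^esub> proj p D"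
    using p by (simp add: mult_quotient proj_coset primary_mult mult_component primary_in_sylow)
qed (simp add: p proj_closed)

lemma order_component:
  assumes p: "prime p"
  shows "\<exists>a. order (component p) = p ^ a"
proof -
  have "order (component p) * card (residual_part p) = card (the_sylow G p)"
    using group.lagrange[OF subgroup_imp_group[OF subgroup_the_sylow[OF p]]
        normal_imp_subgroup[OF residual_part_normal_sylow[OF p]]]
    by (simp add: component_def FactGroup_def order_def)
  then have "order (component p) dvd p ^ multiplicity p (order G)"
    using card_the_sylow[OF p] by (metis dvd_triv_left)
  then show ?thesis using divides_primepow_nat[OF p] by blast
qed

sublocale Q: prime_power_quotients quotient component proj
proof (intro prime_power_quotients.intro prime_power_quotients_axioms.intro)
  show "group quotient" by (rule group_quotient)
  show "finite (carrier quotient)" by (simp add: carrier_quotient fin)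
  fix p :: nat assume p: "prime p"
  show "group (component p)" using p by (rule group_component)
  show "proj p \<in> hom quotient (component p)" using p by (rule proj_hom)
  show "\<exists>a. order (component p) = p ^ a" using p by (rule order_component)
  show "proj p ` carrier quotient = carrier (component p)"
  proof
    show "proj p ` carrier quotient \<subseteq> carrier (component p)" using p proj_closed by blast
    show "carrier (component p) \<subseteq> proj p ` carrier quotient"
    proof
      fix D assume "D \<in> carrier (component p)"
      then obtain g where g: "g \<in> the_sylow G p" "D = residual_part p #> g"
        by (auto simp: carrier_component)
      then have "D = proj p (residual #> g)"
        using p by (simp add: proj_coset the_sylow_closed primary_sylow)
      then show "D \<in> proj p ` carrier quotient"
        using g p the_sylow_closed by (auto simp: carrier_quotient)
    qed
  qed
next
  fix C assume C: "C \<in> carrier quotient" and triv: "\<And>p. prime p \<Longrightarrow> proj p C = \<one>\<^bsub>component p\<^esub>"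
  obtain x where x: "x \<in> carrier G" "C = residual #> x" using C by (auto simp: carrier_quotient)
  have "x \<in> residual"
  proof (rule mem_subgroup_if_primary[OF subgroup_residual x(1)])
    fix p :: nat assume p: "prime p"
    have "residual_part p #> primary p x = residual_part p"
      using triv[OF p] x p by (simp add: proj_coset one_component)
    then show "primary p x \<in> residual"
      using coset_join1[OF _ primary_closed[OF x(1)] subgroup_residual_part[OF p]]
      by (simp add: residual_part_def)
  qed
  then show "C = \<one>\<^bsub>quotient\<^esub>"
    using x coset_join2[OF x(1) subgroup_residual] by (simp add: quotient_def)
qed

subsection \<open>Primary components of the group of induced automorphisms\<close>

lemma induced_mem_centralizer_iff:
  assumes p: "prime p" and a: "a \<in> carrier A"
  shows "induced a \<in> component_centralizer p \<longleftrightarrow> a \<in> residual_kernel p"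
proof -
  have "induced a (embed (residual_part p #> g)) = embed (residual_part p #> g) \<longleftrightarrow>
      act a g \<otimes> inv g \<in> residual" if g: "g \<in> the_sylow G p" for g
    using the_sylow_closed[OF p g] a
    by (simp add: embed_coset[OF p] induced_coset coset_eq_iff[OF subgroup_residual])
  then show ?thesis
    using a by (auto simp: component_centralizer_def residual_kernel_def carrier_induced_group carrier_component)
qed

lemma component_centralizer_eq:
  "prime p \<Longrightarrow> component_centralizer p = induced ` residual_kernel p"
  using induced_mem_centralizer_iff
  by (auto simp: component_centralizer_def carrier_induced_group residual_kernel_def)

lemma component_centralizer_normal:
  assumes p: "prime p"
  shows "component_centralizer p \<lhd> induced_group"
  unfolding component_centralizer_eq[OF p]
  by (rule normal.surj_hom_normal_subgroup[OF residual_kernel_normal[OF p] induced_group_hom])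
    (simp add: carrier_induced_group)

text \<open>This quotient of the induced group is also the quotient of \<open>A\<close> by \<open>residual_kernel p\<close>.\<close>

lemma order_induced_group_Mod:
  assumes p: "prime p"
  shows "\<exists>a. order (induced_group Mod component_centralizer p) = p ^ a"
proof -
  let ?C = "component_centralizer p"
  let ?h = "\<lambda>a. ?C #>\<^bsub>induced_group\<^esub> induced a"
  interpret C: normal ?C induced_group using p by (rule component_centralizer_normal)
  have sub: "subgroup ?C induced_group" by (rule C.is_subgroup)
  interpret h: group_hom A "induced_group Mod ?C" ?h
    unfolding group_hom_def group_hom_axioms_def
    using Group.hom_compose[OF group_hom.homh[OF induced_group_hom] C.r_coset_hom_Mod]
    by (simp add: A.is_group C.factorgroup_is_group comp_def)
  have ker: "kernel A (induced_group Mod ?C) ?h = residual_kernel p"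
  proof -
    have "?h a = ?C \<longleftrightarrow> a \<in> residual_kernel p" if a: "a \<in> carrier A" for a
      using group.coset_join1[OF group_induced_group _ _ sub] group.coset_join2[OF group_induced_group _ sub]
        induced_mem_centralizer_iff[OF p a] a by (auto simp: carrier_induced_group)
    then show ?thesis by (auto simp: kernel_def residual_kernel_def)
  qed
  have "?h ` carrier A = carrier (induced_group Mod ?C)"
    by (auto simp: carrier_FactGroup carrier_induced_group)
  from h.FactGroup_iso[OF this] have "order (induced_group Mod ?C) = order (A Mod residual_kernel p)"
    unfolding ker order_def by (simp add: iso_same_card)
  then show ?thesis
    using index_residual_kernel[OF p] by (simp add: order_def FactGroup_def)
qed

sublocale D: prime_power_quotients induced_group "\<lambda>p. induced_group Mod component_centralizer p"
  "\<lambda>p \<delta>. component_centralizer p #>\<^bsub>induced_group\<^esub> \<delta>"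
proof (intro prime_power_quotients.intro prime_power_quotients_axioms.intro)
  show "group induced_group" by (rule group_induced_group)
  show "finite (carrier induced_group)" by (rule finite_induced_group)
  fix p :: nat assume p: "prime p"
  note C = component_centralizer_normal[OF p]
  show "group (induced_group Mod component_centralizer p)"
    using C by (rule normal.factorgroup_is_group)
  show "(\<lambda>\<delta>. component_centralizer p #>\<^bsub>induced_group\<^esub> \<delta>) \<in>
      hom induced_group (induced_group Mod component_centralizer p)"
    using C by (rule normal.r_coset_hom_Mod)
  show "(\<lambda>\<delta>. component_centralizer p #>\<^bsub>induced_group\<^esub> \<delta>) ` carrier induced_group =
      carrier (induced_group Mod component_centralizer p)"
    by (simp add: carrier_FactGroup)
  show "\<exists>a. order (induced_group Mod component_centralizer p) = p ^ a"
    using p by (rule order_induced_group_Mod)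
next
  fix \<delta> assume \<delta>: "\<delta> \<in> carrier induced_group"
    and triv: "\<And>p. prime p \<Longrightarrow> component_centralizer p #>\<^bsub>induced_group\<^esub> \<delta> =
      \<one>\<^bsub>induced_group Mod component_centralizer p\<^esub>"
  obtain a where a: "a \<in> carrier A" "\<delta> = induced a" using \<delta> by (auto simp: carrier_induced_group)
  have ker: "a \<in> residual_kernel p" if p: "prime p" for p
    using group.coset_join1[OF group_induced_group _ \<delta> normal_imp_subgroup[OF component_centralizer_normal[OF p]]]
      triv[OF p] induced_mem_centralizer_iff[OF p a(1)] a(2) by simp
  have "induced a = induced \<one>\<^bsub>A\<^esub>"
  proof (rule induced_eqI[OF a(1) A.one_closed])
    fix x assume x: "x \<in> carrier G"
    have "act a x \<otimes> inv x \<in> residual"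
    proof (rule mem_subgroup_if_primary[OF subgroup_residual])
      show "act a x \<otimes> inv x \<in> carrier G" using a x by simp
      fix p :: nat assume p: "prime p"
      show "primary p (act a x \<otimes> inv x) \<in> residual"
        using ker[OF p] primary_in_sylow[OF p x] a x p
        by (simp add: primary_mult primary_inv residual_kernel_def flip: act_primary)
    qed
    then show "residual #> act a x = residual #> act \<one>\<^bsub>A\<^esub> x"
      using a x by (simp add: coset_eq_iff[OF subgroup_residual] act_one)
  qed
  then show "\<delta> = \<one>\<^bsub>induced_group\<^esub>"
    using a group_hom.hom_one[OF induced_group_hom] by simp
qed

lemma sylow_centralizes_component:
  assumes "prime p" "prime q" "q \<noteq> p" "sylow_subgroup q induced_group S"
  shows "S \<subseteq> component_centralizer p"
proof
  fix \<delta> assume \<delta>: "\<delta> \<in> S"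
  have "component_centralizer p #>\<^bsub>induced_group\<^esub> \<delta> = component_centralizer p"
    using D.sylow_in_kernel[OF assms(1,2) _ assms(4) \<delta>] assms(3) by simp
  moreover have "\<delta> \<in> carrier induced_group"
    using \<delta> assms(4) by (auto simp: sylow_subgroup_def subgroup.mem_carrier)
  ultimately show "\<delta> \<in> component_centralizer p"
    using group.coset_join1[OF group_induced_group] normal_imp_subgroup[OF component_centralizer_normal[OF assms(1)]]
    by blast
qed

subsection \<open>The semidirect product\<close>

lemma restr_coset:
  assumes p: "prime p" and a: "a \<in> carrier A" and g: "g \<in> the_sylow G p"
  shows "restr p (induced a) (residual_part p #> g) = residual_part p #> act a g"
proof -
  have gG: "g \<in> carrier G" using p g by (rule the_sylow_closed)
  then have "proj p (residual #> act a g) = residual_part p #> act a g"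
    using p a g by (simp add: proj_coset primary_sylow act_sylow)
  then show ?thesis
    using p a g gG by (auto simp: restr_def carrier_component embed_coset induced_coset)
qed

lemma restr_eqI:
  assumes p: "prime p" and b: "b \<in> residual_kernel p" and a: "a \<in> carrier A"
  shows "restr p (induced (b \<otimes>\<^bsub>A\<^esub> a)) = restr p (induced a)"
proof
  fix D
  have bA: "b \<in> carrier A" using b by (simp add: residual_kernel_def)
  show "restr p (induced (b \<otimes>\<^bsub>A\<^esub> a)) D = restr p (induced a) D"
  proof (cases "D \<in> carrier (component p)")
    case True
    then obtain g where g: "g \<in> the_sylow G p" "D = residual_part p #> g"
      by (auto simp: carrier_component)
    have h: "act a g \<in> the_sylow G p" using act_sylow p a g by blast
    have "act b (act a g) \<otimes> inv (act a g) \<in> residual_part p"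
      using b h act_sylow[OF p bA h] subgroup_the_sylow[OF p]
      by (simp add: residual_part_def residual_kernel_def subgroup.m_closed subgroup.m_inv_closed)
    then have "residual_part p #> act b (act a g) = residual_part p #> act a g"
      using coset_eq_iff[OF subgroup_residual_part[OF p]] the_sylow_closed[OF p] h act_sylow[OF p bA h]
      by blast
    then show ?thesis
      using g a bA by (simp add: restr_coset[OF p] act_act the_sylow_closed[OF p])
  qed (simp add: restr_def)
qed

lemma component_action_coset:
  assumes p: "prime p" and a: "a \<in> carrier A"
  shows "component_action p (component_centralizer p #>\<^bsub>induced_group\<^esub> induced a) = restr p (induced a)"
proof -
  have "restr p ` (component_centralizer p #>\<^bsub>induced_group\<^esub> induced a) =
      (\<lambda>b. restr p (induced (b \<otimes>\<^bsub>A\<^esub> a))) ` residual_kernel p"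
    using a by (auto simp: r_coset_def component_centralizer_eq[OF p] induced_group_mult
        residual_kernel_def image_image image_UN)
  also have "\<dots> = (\<lambda>b. restr p (induced a)) ` residual_kernel p"
    using restr_eqI[OF p _ a] by (intro image_cong) auto
  also have "\<dots> = {restr p (induced a)}"
    using subgroup.one_closed[OF normal_imp_subgroup[OF residual_kernel_normal[OF p]]] by auto
  finally show ?thesis by (simp add: component_action_def)
qed

lemma component_action_proj:
  assumes p: "prime p" and \<delta>: "\<delta> \<in> carrier induced_group" and C: "C \<in> carrier quotient"
  shows "component_action p (component_centralizer p #>\<^bsub>induced_group\<^esub> \<delta>) (proj p C) = proj p (\<delta> C)"
proof -
  obtain a where a: "a \<in> carrier A" "\<delta> = induced a" using \<delta> by (auto simp: carrier_induced_group)
  obtain x where x: "x \<in> carrier G" "C = residual #> x" using C by (auto simp: carrier_quotient)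
  show ?thesis
    using a x p
    by (simp add: component_action_coset proj_coset restr_coset primary_in_sylow induced_coset act_primary)
qed

end

lemma hom_product_group_component:
  assumes f: "(\<lambda>x. \<lambda>i \<in> I. f i x) \<in> hom N (product_group I N')" and i: "i \<in> I"
  shows "f i \<in> hom N (N' i)"
proof (rule homI)
  fix x assume x: "x \<in> carrier N"
  have "(\<lambda>i \<in> I. f i x) \<in> (\<Pi>\<^sub>E i\<in>I. carrier (N' i))"
    using hom_in_carrier[OF f x] unfolding carrier_product_group .
  from PiE_mem[OF this i] show "f i x \<in> carrier (N' i)" using i by simp
next
  fix x y assume x: "x \<in> carrier N" and y: "y \<in> carrier N"
  from fun_cong[OF hom_mult[OF f x y], of i]
  show "f i (x \<otimes>\<^bsub>N\<^esub> y) = f i x \<otimes>\<^bsub>N' i\<^esub> f i y"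
    using i by simp
qed

lemma iso_semidirect_product_componentwise:
  assumes f: "(\<lambda>x. \<lambda>i \<in> I. f i x) \<in> iso N (product_group I N')"
    and g: "(\<lambda>x. \<lambda>i \<in> I. g i x) \<in> iso H (product_group I H')"
    and closed: "\<And>h n. \<lbrakk>h \<in> carrier H; n \<in> carrier N\<rbrakk> \<Longrightarrow> \<phi> h n \<in> carrier N"
    and compat: "\<And>i h n. \<lbrakk>i \<in> I; h \<in> carrier H; n \<in> carrier N\<rbrakk> \<Longrightarrow> \<phi>' i (g i h) (f i n) = f i (\<phi> h n)"
  shows "(\<lambda>(n, h). \<lambda>i \<in> I. (f i n, g i h)) \<in>
    iso (semidirect_product N H \<phi>) (product_group I (\<lambda>i. semidirect_product (N' i) (H' i) (\<phi>' i)))"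
    (is "?F \<in> iso ?S ?P")
proof -
  have fh: "i \<in> I \<Longrightarrow> f i \<in> hom N (N' i)" and gh: "i \<in> I \<Longrightarrow> g i \<in> hom H (H' i)" for i
    using f g hom_product_group_component[of f I N N' i] hom_product_group_component[of g I H H' i]
    by (simp_all add: iso_def)
  have hom: "?F \<in> hom ?S ?P"
  proof (rule homI)
    fix x assume "x \<in> carrier ?S"
    then show "?F x \<in> carrier ?P"
      using hom_in_carrier[OF fh] hom_in_carrier[OF gh] by (auto simp: semidirect_product_def)
  next
    fix x y assume "x \<in> carrier ?S" "y \<in> carrier ?S"
    then obtain n h n' h' where xy: "x = (n, h)" "y = (n', h')"
      "n \<in> carrier N" "h \<in> carrier H" "n' \<in> carrier N" "h' \<in> carrier H"
      by (auto simp: semidirect_product_def)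
    show "?F (x \<otimes>\<^bsub>?S\<^esub> y) = ?F x \<otimes>\<^bsub>?P\<^esub> ?F y"
      using xy(3-6) closed[OF xy(4,5)]
      by (auto simp: xy(1,2) semidirect_product_def hom_mult[OF fh] hom_mult[OF gh] compat
          intro!: restrict_ext)
  qed
  have injf: "inj_on (\<lambda>x. \<lambda>i \<in> I. f i x) (carrier N)"
    and surjf: "(\<lambda>x. \<lambda>i \<in> I. f i x) ` carrier N = (\<Pi>\<^sub>E i\<in>I. carrier (N' i))"
    using f by (auto simp: iso_def bij_betw_def)
  have injg: "inj_on (\<lambda>x. \<lambda>i \<in> I. g i x) (carrier H)"
    and surjg: "(\<lambda>x. \<lambda>i \<in> I. g i x) ` carrier H = (\<Pi>\<^sub>E i\<in>I. carrier (H' i))"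
    using g by (auto simp: iso_def bij_betw_def)
  have inj: "inj_on ?F (carrier ?S)"
  proof (rule inj_onI)
    fix x y assume "x \<in> carrier ?S" "y \<in> carrier ?S" and eq: "?F x = ?F y"
    then obtain n h n' h' where xy: "x = (n, h)" "y = (n', h')"
      "n \<in> carrier N" "h \<in> carrier H" "n' \<in> carrier N" "h' \<in> carrier H"
      by (auto simp: semidirect_product_def)
    have "f i n = f i n' \<and> g i h = g i h'" if "i \<in> I" for i
      using fun_cong[OF eq, of i] that by (simp add: xy(1,2))
    then have "(\<lambda>i \<in> I. f i n) = (\<lambda>i \<in> I. f i n')" "(\<lambda>i \<in> I. g i h) = (\<lambda>i \<in> I. g i h')"
      by (auto intro!: restrict_ext)
    then show "x = y"
      using inj_onD[OF injf _ xy(3,5)] inj_onD[OF injg _ xy(4,6)] by (simp add: xy(1,2))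
  qed
  have surj: "carrier ?P \<subseteq> ?F ` carrier ?S"
  proof
    fix z assume z: "z \<in> carrier ?P"
    then have zi: "fst (z i) \<in> carrier (N' i)" "snd (z i) \<in> carrier (H' i)" if "i \<in> I" for i
      using that by (fastforce simp: semidirect_product_def PiE_iff)+
    then have "(\<lambda>i \<in> I. fst (z i)) \<in> (\<Pi>\<^sub>E i\<in>I. carrier (N' i))"
      "(\<lambda>i \<in> I. snd (z i)) \<in> (\<Pi>\<^sub>E i\<in>I. carrier (H' i))" by auto
    then obtain n h where nh: "n \<in> carrier N" "(\<lambda>i \<in> I. f i n) = (\<lambda>i \<in> I. fst (z i))"
      "h \<in> carrier H" "(\<lambda>i \<in> I. g i h) = (\<lambda>i \<in> I. snd (z i))"
      using surjf surjg by (smt (verit) imageE)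
    have "(f i n, g i h) = z i" if "i \<in> I" for i
      using that fun_cong[OF nh(2), of i] fun_cong[OF nh(4), of i] by simp
    then have "?F (n, h) = z"
      using z by (auto simp: PiE_iff extensional_def)
    then show "z \<in> ?F ` carrier ?S"
      using nh by (force simp: semidirect_product_def)
  qed
  show ?thesis
    using hom inj surj hom_carrier[OF hom] by (simp add: iso_def bij_betw_def subset_antisym)
qed

context nilpotent_group_action
begin

lemma iso_semidirect_product_components:
  "(\<lambda>(C, \<delta>). \<lambda>p \<in> {p. prime p}. (proj p C, component_centralizer p #>\<^bsub>induced_group\<^esub> \<delta>)) \<in>
    iso (semidirect_product quotient induced_group (\<lambda>\<delta>. \<delta>))
      (product_group {p. prime p} (\<lambda>p. semidirect_product (component p)
        (induced_group Mod component_centralizer p) (component_action p)))"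
proof (rule iso_semidirect_product_componentwise[OF
      Q.iso_product_of_quotients D.iso_product_of_quotients])
  fix \<delta> C assume "\<delta> \<in> carrier induced_group" "C \<in> carrier quotient"
  then show "\<delta> C \<in> carrier quotient" by (auto simp: carrier_induced_group induced_closed)
qed (simp add: component_action_proj)

end

section \<open>Skew braces of nilpotent type\<close>

context skew_brace
begin

text \<open>Written as $a b = a + \lambda_a(b)$, distributivity says that $\lambda_a$ is additive, which makes
  the two identity elements equal, and associativity then says that $\lambda$ is an action.\<close>

lemma brace_lambda_action:
  assumes fin: "finite (carrier X)" and nil: "nilpotent_type X"
  shows "nilpotent_group_action (add_monoid X) X (brace_lambda X)"
proof -
  interpret G: group "add_monoid X" by (rule add_group)
  interpret M: group X by (rule mult_group)
  have lam: "brace_lambda X a b = inv\<^bsub>add_monoid X\<^esub> a \<otimes>\<^bsub>add_monoid X\<^esub> (a \<otimes> b)" for a b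
    by (simp add: brace_lambda_def a_inv_def)
  have dist: "a \<otimes> (b \<oplus> c) = a \<otimes> b \<oplus> (inv\<^bsub>add_monoid X\<^esub> a \<oplus> a \<otimes> c)"
    if "a \<in> carrier X" "b \<in> carrier X" "c \<in> carrier X" for a b c
    using brace_distrib[OF that] G.m_assoc[of "a \<otimes> b" "inv\<^bsub>add_monoid X\<^esub> a" "a \<otimes> c"] that G.inv_closed[of a]
    by (simp add: a_minus_def a_inv_def)
  have closed: "brace_lambda X a b \<in> carrier X" if "a \<in> carrier X" "b \<in> carrier X" for a b
    using that G.m_closed[OF G.inv_closed[of a], of "a \<otimes> b"] by (simp add: lam)
  have mult: "a \<otimes> b = a \<oplus> brace_lambda X a b" if "a \<in> carrier X" "b \<in> carrier X" for a b
    using that G.mult_cancel_inv_left[of a "a \<otimes> b"] by (simp add: lam)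
  have add: "brace_lambda X a (b \<oplus> c) = brace_lambda X a b \<oplus> brace_lambda X a c"
    if "a \<in> carrier X" "b \<in> carrier X" "c \<in> carrier X" for a b c
    using that G.m_assoc[of "inv\<^bsub>add_monoid X\<^esub> a" "a \<otimes> b" "inv\<^bsub>add_monoid X\<^esub> a \<oplus> a \<otimes> c"] G.inv_closed[of a]
      G.m_closed[of "inv\<^bsub>add_monoid X\<^esub> a" "a \<otimes> c"]
    by (simp add: lam dist)
  have hom: "group_hom (add_monoid X) (add_monoid X) (brace_lambda X a)" if "a \<in> carrier X" for a
    unfolding group_hom_def group_hom_axioms_def
    using that add closed by (auto intro!: homI add_group)
  have zero: "brace_lambda X a \<zero> = \<zero>" if "a \<in> carrier X" for a
    using group_hom.hom_one[OF hom[OF that]] by simp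
  have one: "\<one> = \<zero>"
    using mult[of \<one> \<zero>] zero[of \<one>] G.one_closed G.r_one[of \<one>] by simp
  have act: "brace_lambda X (a \<otimes> b) c = brace_lambda X a (brace_lambda X b c)"
    if "a \<in> carrier X" "b \<in> carrier X" "c \<in> carrier X" for a b c
  proof -
    have "a \<otimes> b \<oplus> brace_lambda X (a \<otimes> b) c = a \<otimes> (b \<oplus> brace_lambda X b c)"
      using that by (simp add: mult[symmetric] M.m_assoc)
    also have "\<dots> = a \<oplus> (brace_lambda X a b \<oplus> brace_lambda X a (brace_lambda X b c))"
      using that G.m_closed[of b "brace_lambda X b c"] by (simp add: mult[of a] closed add)
    also have "\<dots> = a \<otimes> b \<oplus> brace_lambda X a (brace_lambda X b c)"
      using that G.m_assoc[of a "brace_lambda X a b" "brace_lambda X a (brace_lambda X b c)"]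
      by (simp add: mult[of a b] closed)
    finally show ?thesis
      using that inj_onD[OF G.inj_on_cmult[of "a \<otimes> b"],
          of "brace_lambda X (a \<otimes> b) c" "brace_lambda X a (brace_lambda X b c)"]
      by (simp add: closed)
  qed
  have "brace_lambda X \<one> x = x" if "x \<in> carrier X" for x
    using mult[of \<one> x] that G.l_one[of "brace_lambda X \<one> x"] closed[of \<one> x] M.l_one[of x]
      M.one_closed by (simp add: one[symmetric])
  then show ?thesis
    using fin nil hom act
    by (intro nilpotent_group_action.intro nilpotent_group_action_axioms.intro
        finite_nilpotent_group.intro finite_nilpotent_group_axioms.intro add_group mult_group)
      (auto simp: nilpotent_type_def group_hom_def group_hom_axioms_def)
qed

end

theorem proposition6p6:
  fixes X :: "('a, 'm) ring_scheme"
  assumes "skew_brace X"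
    and "finite (carrier X)"
    and "nilpotent_type X"
  shows "Delta_to_prod X \<in> iso (Delta X) (product_group {p. prime p} (Delta_p X)) \<and>
    semidirect_to_prod X \<in>
      iso (semidirect_product (Q_quot X) (Delta X) (\<lambda>\<delta>. \<delta>))
          (product_group {p. prime p}
            (\<lambda>p. semidirect_product (Q_p X p) (Delta_p X p) (Delta_p_action X p))) \<and>
    (\<forall>q. prime q \<longrightarrow> (\<exists>!S. sylow_subgroup q (Delta X) S)) \<and>
    (\<forall>p q S. prime p \<and> prime q \<and> q \<noteq> p \<and> sylow_subgroup q (Delta X) S
       \<longrightarrow> S \<subseteq> Delta_centralizer X p)"
proof -
  interpret skew_brace X by fact
  interpret N: nilpotent_group_action "add_monoid X" X "brace_lambda X"
    using brace_lambda_action assms by blast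
  have star: "brace_star X a b = brace_lambda X a b \<otimes>\<^bsub>add_monoid X\<^esub> inv\<^bsub>add_monoid X\<^esub> b" for a b
    by (simp add: brace_star_def a_minus_def a_inv_def)
  have series: "left_series X n = N.commutator_series n" for n
    by (induction n) (simp_all add: brace_star_set_def star)
  have L: "L_inf X = N.residual"
    unfolding L_inf_def N.residual_def series ..
  have Q: "Q_quot X = N.quotient"
    unfolding Q_quot_def N.quotient_def L ..
  have ind: "induced_aut X = N.induced"
    unfolding induced_aut_def N.induced_def Q ..
  have D: "Delta X = N.induced_group"
    unfolding Delta_def N.induced_group_def Q ind ..
  have Gp: "G_p X = the_sylow (add_monoid X)"
    unfolding G_p_def ..
  have Lp: "L_p X = N.residual_part"
    unfolding L_p_def N.residual_part_def L Gp ..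
  have Qp: "Q_p X = N.component"
    unfolding Q_p_def N.component_def Gp Lp ..
  have Gc: "G_p_compl X = N.sylow_complement"
    unfolding G_p_compl_def N.sylow_complement_def Gp ..
  have emb: "Q_embed X = N.embed"
    unfolding Q_embed_def N.embed_def L ..
  have pr: "Q_proj X = N.proj"
    by (simp add: Q_proj_def N.proj_def Gp Gc fun_eq_iff)
  have cent: "Delta_centralizer X = N.component_centralizer"
    unfolding Delta_centralizer_def N.component_centralizer_def D Qp emb ..
  have Dp: "Delta_p X = (\<lambda>p. N.induced_group Mod N.component_centralizer p)"
    unfolding Delta_p_def D cent ..
  have res: "Delta_restr X = N.restr"
    unfolding Delta_restr_def N.restr_def Qp pr emb ..
  have act: "Delta_p_action X = N.component_action"
    unfolding Delta_p_action_def N.component_action_def res ..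
  have to_prod: "Delta_to_prod X =
      (\<lambda>\<delta>. \<lambda>p \<in> {p. prime p}. N.component_centralizer p #>\<^bsub>N.induced_group\<^esub> \<delta>)"
    unfolding Delta_to_prod_def D cent ..
  have semi: "semidirect_to_prod X = (\<lambda>(C, \<delta>). \<lambda>p \<in> {p. prime p}.
      (N.proj p C, N.component_centralizer p #>\<^bsub>N.induced_group\<^esub> \<delta>))"
    unfolding semidirect_to_prod_def to_prod pr by (auto intro!: restrict_ext)
  show ?thesis
    unfolding to_prod semi D Dp Q Qp act cent
    using N.D.iso_product_of_quotients N.iso_semidirect_product_components
      N.D.sylow_unique N.sylow_centralizes_component
    by blast
qed

end
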